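(* Let $P$ be a finitely generated non-symmetric operad over a field $\Bbbk$ of characteristic zero which has a finite Gröbner basis. Then its ordinary generating series $G_P(z)=\sum_{n\ge 1}\dim P(n)\,z^n$ is an algebraic function, i.e. there is a nonzero polynomial $Q(z,y)\in\mathbb{Q}[z,y]$ with $Q(z,G_P(z))=0$ in $\mathbb{Q}[[z]]$.
   Context: $\Bbbk$ is a field of characteristic zero. A non-symmetric (linear) operad $P$ is a collection of $\Bbbk$-vector spaces $P(n)$, $n\ge1$, with an identity in $P(1)$ and partial compositions $\circ_i:P(n)\otimes P(m)\to P(n+m-1)$, $1\le i\le n$, satisfying the usual associativity and unit axioms. For a set $\Upsilon=\bigsqcup_{n\ge1}\Upsilon_n$ of generators ($\Upsilon_n$ consists of the $n$-ary ones), the free non-symmetric operad $F(\Upsilon)$ has as linear basis the tree monomials: planar rooted trees in which each vertex has at least one input and each vertex with $n$ inputs is labeled by an element of $\Upsilon_n$ (the trivial tree without vertices is the identity); the arity of a tree is its number of leaves, and composition is grafting. A tree monomial $v$ is divisible by $w$ if $v$ contains a (connected) planar labeled subtree isomorphic to $w$, whose root need not be the root of $v$. An admissible order is a total well-order on the tree monomials of each arity, compatible with compositions; the leading monomial of a nonzero element of $F(\Upsilon)(n)$ is its largest monomial. Let $P=F(\Upsilon)/C$ with $C$ an operadic ideal. A Gröbner basis of $C$ is a subset $G\subset C$ such that the leading monomial of every nonzero element of $C$ is divisible by the leading monomial of some element of $G$. "$P$ has a finite Gröbner basis" means that $P=F(\Upsilon)/C$ with $\Upsilon$ finite and $C$ has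 a finite Gröbner basis for some admissible order. All components $P(n)$ are finite-dimensional, so that $G_P$ is defined. *)

theory Defs
  imports
    "HOL-Library.Poly_Mapping"
    "HOL-Computational_Algebra.Polynomial"
    "HOL-Computational_Algebra.Polynomial_FPS"
begin

section \<open>Non-symmetric operads\<close>

text \<open>
  The components \<open>P(n)\<close>, \<open>n \<ge> 1\<close>, are linear subspaces of one ambient vector space.  They are not
  required to be disjoint or independent (nor is \<open>P(0)\<close> ever looked at), so every family of vector
  spaces is covered, for instance inside its direct sum.  Since an element does not
  determine its arity, \<open>pcomp P n m i\<close>, which stands for the partial composition
  \<open>\<circ>\<^sub>i : P(n) \<otimes> P(m) \<rightarrow> P(n + m - 1)\<close>, carries both arities.
\<close>

record ('k, 'p) operad =
  scale :: "'k \<Rightarrow> 'p \<Rightarrow> 'p"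
  component :: "nat \<Rightarrow> 'p set"
  ident :: 'p
  pcomp :: "nat \<Rightarrow> nat \<Rightarrow> nat \<Rightarrow> 'p \<Rightarrow> 'p \<Rightarrow> 'p"

locale ns_operad =
  fixes P :: "('k::field, 'p::ab_group_add) operad"
  assumes vector_space: "vector_space (scale P)"
    and subspace: "n \<ge> 1 \<Longrightarrow> module.subspace (scale P) (component P n)"
    and ident_closed: "ident P \<in> component P 1"
    and pcomp_closed:
      "\<lbrakk>1 \<le> i; i \<le> n; m \<ge> 1; x \<in> component P n; y \<in> component P m\<rbrakk>
        \<Longrightarrow> pcomp P n m i x y \<in> component P (n + m - 1)"
    and pcomp_add_left:
      "\<lbrakk>1 \<le> i; i \<le> n; m \<ge> 1; x \<in> component P n; x' \<in> component P n; y \<in> component P m\<rbrakk>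
        \<Longrightarrow> pcomp P n m i (x + x') y = pcomp P n m i x y + pcomp P n m i x' y"
    and pcomp_add_right:
      "\<lbrakk>1 \<le> i; i \<le> n; m \<ge> 1; x \<in> component P n; y \<in> component P m; y' \<in> component P m\<rbrakk>
        \<Longrightarrow> pcomp P n m i x (y + y') = pcomp P n m i x y + pcomp P n m i x y'"
    and pcomp_scale_left:
      "\<lbrakk>1 \<le> i; i \<le> n; m \<ge> 1; x \<in> component P n; y \<in> component P m\<rbrakk>
        \<Longrightarrow> pcomp P n m i (scale P c x) y = scale P c (pcomp P n m i x y)"
    and pcomp_scale_right:
      "\<lbrakk>1 \<le> i; i \<le> n; m \<ge> 1; x \<in> component P n; y \<in> component P m\<rbrakk>
        \<Longrightarrow> pcomp P n m i x (scale P c y) = scale P c (pcomp P n m i x y)"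
    and ident_left:
      "\<lbrakk>n \<ge> 1; x \<in> component P n\<rbrakk> \<Longrightarrow> pcomp P 1 n 1 (ident P) x = x"
    and ident_right:
      "\<lbrakk>1 \<le> i; i \<le> n; x \<in> component P n\<rbrakk> \<Longrightarrow> pcomp P n 1 i x (ident P) = x"
    and sequential_assoc:
      "\<lbrakk>1 \<le> i; i \<le> l; 1 \<le> j; j \<le> m; n \<ge> 1;
        x \<in> component P l; y \<in> component P m; z \<in> component P n\<rbrakk>
        \<Longrightarrow> pcomp P (l + m - 1) n (i + j - 1) (pcomp P l m i x y) z
            = pcomp P l (m + n - 1) i x (pcomp P m n j y z)"
    and parallel_assoc:
      "\<lbrakk>1 \<le> i; i < k; k \<le> l; m \<ge> 1; n \<ge> 1;
        x \<in> component P l; y \<in> component P m; z \<in> component P n\<rbrakk>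
        \<Longrightarrow> pcomp P (l + m - 1) n (k + m - 1) (pcomp P l m i x y) z
            = pcomp P (l + n - 1) m i (pcomp P l n k x z) y"

definition suboperad :: "(nat \<Rightarrow> 'p set) \<Rightarrow> ('k::field, 'p::ab_group_add) operad \<Rightarrow> bool" where
  "suboperad S P \<longleftrightarrow>
     (\<forall>n\<ge>1. S n \<subseteq> component P n \<and> module.subspace (scale P) (S n)) \<and>
     ident P \<in> S 1 \<and>
     (\<forall>n m i x y. 1 \<le> i \<longrightarrow> i \<le> n \<longrightarrow> m \<ge> 1 \<longrightarrow> x \<in> S n \<longrightarrow> y \<in> S m
        \<longrightarrow> pcomp P n m i x y \<in> S (n + m - 1))"

text \<open>Elements of the disjoint union of the components are pairs of an arity and an element.\<close>

definition finitely_generated :: "('k::field, 'p::ab_group_add) operad \<Rightarrow> bool" where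
  "finitely_generated P \<longleftrightarrow>
     (\<exists>X. finite X \<and> X \<subseteq> Sigma {1..} (component P) \<and>
        (\<forall>S. suboperad S P \<and> X \<subseteq> Sigma {1..} S \<longrightarrow> (\<forall>n\<ge>1. S n = component P n)))"

definition operad_ideal :: "(nat \<Rightarrow> 'p set) \<Rightarrow> ('k::field, 'p::ab_group_add) operad \<Rightarrow> bool" where
  "operad_ideal C P \<longleftrightarrow>
     (\<forall>n\<ge>1. C n \<subseteq> component P n \<and> module.subspace (scale P) (C n)) \<and>
     (\<forall>n m i x y. 1 \<le> i \<longrightarrow> i \<le> n \<longrightarrow> m \<ge> 1 \<longrightarrow> x \<in> C n \<longrightarrow> y \<in> component P m
        \<longrightarrow> pcomp P n m i x y \<in> C (n + m - 1)) \<and>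
     (\<forall>n m i x y. 1 \<le> i \<longrightarrow> i \<le> n \<longrightarrow> m \<ge> 1 \<longrightarrow> x \<in> component P n \<longrightarrow> y \<in> C m
        \<longrightarrow> pcomp P n m i x y \<in> C (n + m - 1))"

definition cong_mod :: "('k::field, 'p::ab_group_add) operad \<Rightarrow> (nat \<Rightarrow> 'p set) \<Rightarrow> nat \<Rightarrow> ('p \<times> 'p) set" where
  "cong_mod F C n = {(x, y). x \<in> component F n \<and> y \<in> component F n \<and> x - y \<in> C n}"

definition coset :: "('k::field, 'p::ab_group_add) operad \<Rightarrow> (nat \<Rightarrow> 'p set) \<Rightarrow> nat \<Rightarrow> 'p \<Rightarrow> 'p set" where
  "coset F C n x = cong_mod F C n `` {x}"

text \<open>
  An isomorphism of operads from the quotient \<open>F/C\<close> to \<open>P\<close>: the components of \<open>F/C\<close> are the sets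
  of cosets, and its operations are the ones induced on representatives.
\<close>

definition quotient_isomorphism ::
  "('k::field, 'f::ab_group_add) operad \<Rightarrow> (nat \<Rightarrow> 'f set) \<Rightarrow> ('k, 'p::ab_group_add) operad
    \<Rightarrow> (nat \<Rightarrow> 'f set \<Rightarrow> 'p) \<Rightarrow> bool" where
  "quotient_isomorphism F C P \<phi> \<longleftrightarrow>
     (\<forall>n\<ge>1. bij_betw (\<phi> n) (component F n // cong_mod F C n) (component P n)) \<and>
     (\<forall>n\<ge>1. \<forall>x\<in>component F n. \<forall>y\<in>component F n.
        \<phi> n (coset F C n (x + y)) = \<phi> n (coset F C n x) + \<phi> n (coset F C n y)) \<and>
     (\<forall>n\<ge>1. \<forall>c. \<forall>x\<in>component F n.
        \<phi> n (coset F C n (scale F c x)) = scale P c (\<phi> n (coset F C n x))) \<and>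
     \<phi> 1 (coset F C 1 (ident F)) = ident P \<and>
     (\<forall>n m i. 1 \<le> i \<longrightarrow> i \<le> n \<longrightarrow> m \<ge> 1 \<longrightarrow> (\<forall>x\<in>component F n. \<forall>y\<in>component F m.
        \<phi> (n + m - 1) (coset F C (n + m - 1) (pcomp F n m i x y))
          = pcomp P n m i (\<phi> n (coset F C n x)) (\<phi> m (coset F C m y))))"

definition finite_dimensional_components :: "('k::field, 'p::ab_group_add) operad \<Rightarrow> bool" where
  "finite_dimensional_components P \<longleftrightarrow>
     (\<forall>n\<ge>1. \<exists>B. finite B \<and> module.span (scale P) B = component P n)"

definition generating_series :: "('k::field, 'p::ab_group_add) operad \<Rightarrow> rat fps" where
  "generating_series P =
     Abs_fps (\<lambda>n. if n = 0 then 0 else of_nat (vector_space.dim (scale P) (component P n)))"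

text \<open>A bivariate polynomial \<open>Q(z, y)\<close> is a polynomial in \<open>y\<close> with coefficients in \<open>\<rat>[z]\<close>.\<close>

definition algebraic_series :: "rat fps \<Rightarrow> bool" where
  "algebraic_series f \<longleftrightarrow>
     (\<exists>Q :: rat poly poly. Q \<noteq> 0 \<and> poly (map_poly fps_of_poly Q) f = 0)"


section \<open>The free non-symmetric operad\<close>

text \<open>\<open>Leaf\<close> is the trivial tree, without vertices.\<close>

datatype 'g tree = Leaf | Node 'g "'g tree list"

fun leaves :: "'g tree \<Rightarrow> nat" where
  "leaves Leaf = 1"
| "leaves (Node a ts) = sum_list (map leaves ts)"

text \<open>
  The generators form a set \<open>U\<close> with an arity function \<open>ar\<close>, so that the \<open>n\<close>-ary ones
  are the \<open>a \<in> U\<close> with \<open>ar a = n\<close>.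
\<close>

inductive_set trees :: "'g set \<Rightarrow> ('g \<Rightarrow> nat) \<Rightarrow> 'g tree set" for U ar where
  Leaf: "Leaf \<in> trees U ar"
| Node: "\<lbrakk>a \<in> U; length ts = ar a; \<And>t. t \<in> set ts \<Longrightarrow> t \<in> trees U ar\<rbrakk> \<Longrightarrow> Node a ts \<in> trees U ar"

definition tree_monomials :: "'g set \<Rightarrow> ('g \<Rightarrow> nat) \<Rightarrow> nat \<Rightarrow> 'g tree set" where
  "tree_monomials U ar n = {t \<in> trees U ar. leaves t = n}"

text \<open>
  \<open>graft s i t\<close> replaces the \<open>i\<close>-th leaf of \<open>s\<close>, counted from the left and starting
  with 1, by \<open>t\<close>; it is only meant for \<open>1 \<le> i \<le> leaves s\<close>.
\<close>

fun graft :: "'g tree \<Rightarrow> nat \<Rightarrow> 'g tree \<Rightarrow> 'g tree"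
  and graft_list :: "'g tree list \<Rightarrow> nat \<Rightarrow> 'g tree \<Rightarrow> 'g tree list" where
  "graft Leaf i t = t"
| "graft (Node a ss) i t = Node a (graft_list ss i t)"
| "graft_list [] i t = []"
| "graft_list (s # ss) i t =
     (if i \<le> leaves s then graft s i t # ss else s # graft_list ss (i - leaves s) t)"

definition free_pcomp :: "nat \<Rightarrow> ('g tree \<Rightarrow>\<^sub>0 'k::field) \<Rightarrow> ('g tree \<Rightarrow>\<^sub>0 'k) \<Rightarrow> ('g tree \<Rightarrow>\<^sub>0 'k)" where
  "free_pcomp i p q =
     (\<Sum>s\<in>Poly_Mapping.keys p. \<Sum>t\<in>Poly_Mapping.keys q.
        Poly_Mapping.single (graft s i t) (Poly_Mapping.lookup p s * Poly_Mapping.lookup q t))"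

definition free_operad :: "'g set \<Rightarrow> ('g \<Rightarrow> nat) \<Rightarrow> ('k::field, 'g tree \<Rightarrow>\<^sub>0 'k) operad" where
  "free_operad U ar =
     \<lparr>scale = (\<lambda>c. Poly_Mapping.map ((*) c)),
      component = (\<lambda>n. {p. Poly_Mapping.keys p \<subseteq> tree_monomials U ar n}),
      ident = Poly_Mapping.single Leaf 1,
      pcomp = (\<lambda>n m. free_pcomp)\<rparr>"

lemma leaves_graft:
  "1 \<le> i \<Longrightarrow> i \<le> leaves s \<Longrightarrow> leaves (graft s i t) + 1 = leaves s + leaves t"
  "1 \<le> i \<Longrightarrow> i \<le> sum_list (map leaves ss) \<Longrightarrow> sum_list (map leaves (graft_list ss i t)) + 1 = sum_list (map leaves ss) + leaves t"
proof (induction s i t and ss i t rule: graft_graft_list.induct)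
qed (auto split: if_splits)

lemma length_graft_list: "length (graft_list ss i t) = length ss"
  by (induction ss arbitrary: i) auto

lemma trees_graft:
  "s \<in> trees U ar \<Longrightarrow> t \<in> trees U ar \<Longrightarrow> graft s i t \<in> trees U ar"
  "set ss \<subseteq> trees U ar \<Longrightarrow> t \<in> trees U ar \<Longrightarrow> set (graft_list ss i t) \<subseteq> trees U ar"
proof (induction s i t and ss i t rule: graft_graft_list.induct)
  case (2 a ss i t)
  then show ?case by (auto elim!: trees.cases[of "Node a ss"] intro!: trees.Node simp: length_graft_list)
qed auto

lemma graft_Leaf:
  fixes s :: "'a tree" and ss :: "'a tree list"
  shows "1 \<le> i \<Longrightarrow> i \<le> leaves s \<Longrightarrow> graft s i Leaf = s"
  "1 \<le> i \<Longrightarrow> i \<le> sum_list (map leaves ss) \<Longrightarrow> graft_list ss i Leaf = ss"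
  by (induction s i "Leaf::'a tree" and ss i "Leaf::'a tree" rule: graft_graft_list.induct) auto

lemma graft_sequential:
  "1 \<le> i \<Longrightarrow> i \<le> leaves s \<Longrightarrow> 1 \<le> j \<Longrightarrow> j \<le> leaves t \<Longrightarrow>
    graft (graft s i t) (i + j - 1) u = graft s i (graft t j u)"
  "1 \<le> i \<Longrightarrow> i \<le> sum_list (map leaves ss) \<Longrightarrow> 1 \<le> j \<Longrightarrow> j \<le> leaves t \<Longrightarrow>
    graft_list (graft_list ss i t) (i + j - 1) u = graft_list ss i (graft t j u)"
proof (induction s i t and ss i t rule: graft_graft_list.induct)
  case (4 s ss i t)
  show ?case
  proof (cases "i \<le> leaves s")
    case True
    then show ?thesis using 4 leaves_graft(1)[of i s t] by auto
  next
    case False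
    have e: "i - leaves s + j - Suc 0 = i + j - Suc 0 - leaves s" using False by auto
    show ?thesis using 4 False by (auto simp: e)
  qed
qed auto

lemma graft_parallel:
  "1 \<le> i \<Longrightarrow> i < k \<Longrightarrow> k \<le> leaves s \<Longrightarrow> 1 \<le> leaves t \<Longrightarrow>
    graft (graft s i t) (k + leaves t - 1) u = graft (graft s k u) i t"
  "1 \<le> i \<Longrightarrow> i < k \<Longrightarrow> k \<le> sum_list (map leaves ss) \<Longrightarrow> 1 \<le> leaves t \<Longrightarrow> 
    graft_list (graft_list ss i t) (k + leaves t - 1) u = graft_list (graft_list ss k u) i t"
proof (induction s i t and ss i t arbitrary: k and k rule: graft_graft_list.induct)
  case (4 s ss i t)
  consider "k \<le> leaves s" | "i \<le> leaves s" "k > leaves s" | "i > leaves s" by linarith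
  then show ?case
  proof cases
    case 1
    have "i \<le> leaves s" using 1 4 by simp
    then show ?thesis using 4 1 leaves_graft(1)[of i s t] leaves_graft(1)[of k s u] 
      by auto
  next
    case 2
    have e: "k + leaves t - Suc 0 - leaves (graft s i t) = k - leaves s"
      using leaves_graft(1)[of i s t] 4 2 by auto
    show ?thesis using 4 2 leaves_graft(1)[of i s t] by (auto simp: e)
  next
    case 3
    have e: "k - leaves s + leaves t - Suc 0 = k + leaves t - Suc 0 - leaves s" using 3 4 by auto
    show ?thesis using "4.IH"(2)[of "k - leaves s"] "4.prems" 3 by (auto simp: e)
  qed
qed auto



lemma lookup_map_times: "Poly_Mapping.lookup (Poly_Mapping.map ((*) c) p) x = (c::'k::field) * Poly_Mapping.lookup p x"
  by (simp add: Poly_Mapping.map.rep_eq when_def)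

lemma keys_map_times: "Poly_Mapping.keys (Poly_Mapping.map ((*) (c::'k::field)) p) \<subseteq> Poly_Mapping.keys p"
  by (auto simp: in_keys_iff lookup_map_times)

lemma vector_space_map_times: "vector_space (\<lambda>c. Poly_Mapping.map ((*) (c::'k::field)) :: ('g \<Rightarrow>\<^sub>0 'k) \<Rightarrow> _)"
  by unfold_locales (auto intro!: poly_mapping_eqI simp: lookup_map_times lookup_add algebra_simps)

lemma free_pcomp_superset:
  assumes "finite A" "Poly_Mapping.keys p \<subseteq> A" "finite B" "Poly_Mapping.keys q \<subseteq> B"
  shows "free_pcomp i p q = (\<Sum>s\<in>A. \<Sum>t\<in>B. Poly_Mapping.single (graft s i t) (Poly_Mapping.lookup p s * Poly_Mapping.lookup q t))"
proof -
  have "free_pcomp i p q = (\<Sum>s\<in>Poly_Mapping.keys p. \<Sum>t\<in>B. Poly_Mapping.single (graft s i t) (Poly_Mapping.lookup p s * Poly_Mapping.lookup q t))"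
    unfolding free_pcomp_def
    by (intro sum.cong refl sum.mono_neutral_left assms) (auto simp: in_keys_iff)
  also have "\<dots> = (\<Sum>s\<in>A. \<Sum>t\<in>B. Poly_Mapping.single (graft s i t) (Poly_Mapping.lookup p s * Poly_Mapping.lookup q t))"
    by (intro sum.mono_neutral_left assms) (auto simp: in_keys_iff)
  finally show ?thesis .
qed

lemma free_pcomp_add_left: "free_pcomp i (p + p') q = free_pcomp i p q + free_pcomp i p' q"
proof -
  let ?A = "Poly_Mapping.keys p \<union> Poly_Mapping.keys p'" and ?B = "Poly_Mapping.keys q"
  note sup = free_pcomp_superset[of ?A _ ?B q i]
  show ?thesis using Poly_Mapping.keys_add[of p p']
    by (subst (1 2 3) sup) (auto simp: lookup_add algebra_simps single_add sum.distrib)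
qed

lemma free_pcomp_add_right: "free_pcomp i q (p + p') = free_pcomp i q p + free_pcomp i q p'"
proof -
  let ?A = "Poly_Mapping.keys p \<union> Poly_Mapping.keys p'" and ?B = "Poly_Mapping.keys q"
  note sup = free_pcomp_superset[of ?B q ?A _ i]
  show ?thesis using Poly_Mapping.keys_add[of p p']
    by (subst (1 2 3) sup) (auto simp: lookup_add algebra_simps single_add sum.distrib)
qed

lemma free_pcomp_zero [simp]: "free_pcomp i 0 q = 0" "free_pcomp i q 0 = 0"
  by (simp_all add: free_pcomp_def)

lemma map_times_single: "Poly_Mapping.map ((*) c) (Poly_Mapping.single x a) = Poly_Mapping.single x ((c::'k::field) * a)"
  by (rule poly_mapping_eqI) (simp add: lookup_map_times lookup_single when_def)

lemma map_times_sum: "Poly_Mapping.map ((*) (c::'k::field)) (sum f A) = (\<Sum>x\<in>A. Poly_Mapping.map ((*) c) (f x))"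
  by (rule poly_mapping_eqI) (simp add: lookup_map_times lookup_sum sum_distrib_left)

lemma free_pcomp_scale_left: "free_pcomp i (Poly_Mapping.map ((*) c) p) q = Poly_Mapping.map ((*) (c::'k::field)) (free_pcomp i p q)"
  by (subst (1 2) free_pcomp_superset[of "Poly_Mapping.keys p" _ "Poly_Mapping.keys q" q i])
     (use keys_map_times[of c p] in \<open>auto simp: map_times_sum map_times_single lookup_map_times mult.assoc\<close>)

lemma free_pcomp_scale_right: "free_pcomp i q (Poly_Mapping.map ((*) c) p) = Poly_Mapping.map ((*) (c::'k::field)) (free_pcomp i q p)"
  by (subst (1 2) free_pcomp_superset[of "Poly_Mapping.keys q" q "Poly_Mapping.keys p" _ i])
     (use keys_map_times[of c p] in \<open>auto simp: map_times_sum map_times_single lookup_map_times mult_ac\<close>)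

lemma free_pcomp_single: "free_pcomp i (Poly_Mapping.single s a) (Poly_Mapping.single t b) = Poly_Mapping.single (graft s i t) (a * b)"
  by (subst free_pcomp_superset[of "{s}" _ "{t}"]) auto

lemma poly_mapping_linear_induct [consumes 1, case_names zero add single]:
  assumes k: "Poly_Mapping.keys p \<subseteq> T" and z: "Q 0" 
   and a: "\<And>p q. Q p \<Longrightarrow> Q q \<Longrightarrow> Q (p + q)" and s: "\<And>t c. t \<in> T \<Longrightarrow> Q (Poly_Mapping.single t c)"
  shows "Q (p :: 'x \<Rightarrow>\<^sub>0 'k::field)"
proof -
  have "p = (\<Sum>t\<in>Poly_Mapping.keys p. Poly_Mapping.single t (Poly_Mapping.lookup p t))"
  proof (rule poly_mapping_eqI)
    fix k
    have "Poly_Mapping.lookup (\<Sum>t\<in>Poly_Mapping.keys p. Poly_Mapping.single t (Poly_Mapping.lookup p t)) k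
      = (\<Sum>t\<in>Poly_Mapping.keys p. if t = k then Poly_Mapping.lookup p k else 0)"
      unfolding lookup_sum by (intro sum.cong refl) (simp add: lookup_single)
    also have "\<dots> = Poly_Mapping.lookup p k"
      by (simp add: in_keys_iff)
    finally show "Poly_Mapping.lookup p k = Poly_Mapping.lookup (\<Sum>t\<in>Poly_Mapping.keys p. Poly_Mapping.single t (Poly_Mapping.lookup p t)) k" ..
  qed
  moreover have "finite X \<Longrightarrow> X \<subseteq> T \<Longrightarrow> Q (\<Sum>t\<in>X. Poly_Mapping.single t (Poly_Mapping.lookup p t))" for X
    by (induction X rule: finite_induct) (auto intro: z a s)
  ultimately show ?thesis using k by (metis finite_keys)
qed

lemma free_operad_ns_operad:
  fixes U :: "'g set"
  shows "ns_operad (free_operad U ar :: ('k::field, 'g tree \<Rightarrow>\<^sub>0 'k) operad)"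
proof -
  interpret vector_space "\<lambda>c. Poly_Mapping.map ((*) (c::'k::field)) :: ('g tree \<Rightarrow>\<^sub>0 'k) \<Rightarrow> _"
    by (rule vector_space_map_times)
  let ?T = "tree_monomials U ar"
  show ?thesis
  proof (unfold_locales; simp add: free_operad_def del: One_nat_def)
    show "subspace {p. Poly_Mapping.keys p \<subseteq> ?T n}" for n
      unfolding subspace_def
    proof (intro conjI ballI allI)
      fix x y :: "'g tree \<Rightarrow>\<^sub>0 'k" and c
      assume "x \<in> {p. Poly_Mapping.keys p \<subseteq> ?T n}" "y \<in> {p. Poly_Mapping.keys p \<subseteq> ?T n}"
      then show "x + y \<in> {p. Poly_Mapping.keys p \<subseteq> ?T n}" using Poly_Mapping.keys_add[of x y] by blast
    next
      fix x :: "'g tree \<Rightarrow>\<^sub>0 'k" and c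
      assume "x \<in> {p. Poly_Mapping.keys p \<subseteq> ?T n}"
      then show "Poly_Mapping.map ((*) c) x \<in> {p. Poly_Mapping.keys p \<subseteq> ?T n}" using keys_map_times[of c x] by blast
    qed simp
    show "Leaf \<in> ?T 1" by (auto simp: tree_monomials_def intro: trees.Leaf)
  next
    fix i n m and x y :: "'g tree \<Rightarrow>\<^sub>0 'k"
    assume a: "1 \<le> i" "i \<le> n" "1 \<le> m" "Poly_Mapping.keys x \<subseteq> ?T n" "Poly_Mapping.keys y \<subseteq> ?T m"
    have "graft s i t \<in> ?T (n + m - 1)" if "s \<in> ?T n" "t \<in> ?T m" for s t
      using that leaves_graft(1)[of i s t] a trees_graft(1)[of s U ar t i] by (auto simp: tree_monomials_def)
    then show "Poly_Mapping.keys (free_pcomp i x y) \<subseteq> ?T (n + m - 1)"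
      unfolding free_pcomp_def using a
      by (intro order.trans[OF Poly_Mapping.keys_sum] UN_least) (auto simp: subset_iff)
  next
    fix n and x :: "'g tree \<Rightarrow>\<^sub>0 'k"
    assume "Poly_Mapping.keys x \<subseteq> ?T n"
    then show "free_pcomp 1 (Poly_Mapping.single Leaf 1) x = x"
      by (induction rule: poly_mapping_linear_induct) (auto simp: free_pcomp_add_right free_pcomp_single)
  next
    fix i n and x :: "'g tree \<Rightarrow>\<^sub>0 'k"
    assume "Poly_Mapping.keys x \<subseteq> ?T n" "1 \<le> i" "i \<le> n"
    then show "free_pcomp i x (Poly_Mapping.single Leaf 1) = x"
      by (induction rule: poly_mapping_linear_induct) (auto simp: free_pcomp_add_left free_pcomp_single graft_Leaf tree_monomials_def)
  next
    fix i l j m n and x y z :: "'g tree \<Rightarrow>\<^sub>0 'k"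
    assume a: "1 \<le> i" "i \<le> l" "1 \<le> j" "j \<le> m" 
      and x: "Poly_Mapping.keys x \<subseteq> ?T l" and y: "Poly_Mapping.keys y \<subseteq> ?T m" and z: "Poly_Mapping.keys z \<subseteq> ?T n"
    show "free_pcomp (i + j - 1) (free_pcomp i x y) z = free_pcomp i x (free_pcomp j y z)"
      using x
    proof (induction rule: poly_mapping_linear_induct)
      case (single s c)
      show ?case using y
      proof (induction rule: poly_mapping_linear_induct)
        case s2: (single t d)
        show ?case using z
        proof (induction rule: poly_mapping_linear_induct)
          case s3: (single u e)
          show ?case using graft_sequential(1)[of i s j t u] a single(1) s2(1)
            unfolding tree_monomials_def free_pcomp_single mult.assoc by simp
        qed (auto simp: free_pcomp_add_right)
      qed (auto simp: free_pcomp_add_right free_pcomp_add_left)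
    qed (auto simp: free_pcomp_add_left)
  next
    fix i k l m n and x y z :: "'g tree \<Rightarrow>\<^sub>0 'k"
    assume a: "1 \<le> i" "i < k" "k \<le> l" "1 \<le> m" 
      and x: "Poly_Mapping.keys x \<subseteq> ?T l" and y: "Poly_Mapping.keys y \<subseteq> ?T m" and z: "Poly_Mapping.keys z \<subseteq> ?T n"
    show "free_pcomp (k + m - 1) (free_pcomp i x y) z = free_pcomp i (free_pcomp k x z) y"
      using x
    proof (induction rule: poly_mapping_linear_induct)
      case (single s c)
      show ?case using y
      proof (induction rule: poly_mapping_linear_induct)
        case s2: (single t d)
        show ?case using z
        proof (induction rule: poly_mapping_linear_induct)
          case s3: (single u e)
          show ?case using graft_parallel(1)[of i k s t u] a single(1) s2(1)
            unfolding tree_monomials_def free_pcomp_single by (simp add: mult_ac)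
        qed (auto simp: free_pcomp_add_right free_pcomp_add_left)
      qed (auto simp: free_pcomp_add_right free_pcomp_add_left)
    qed (auto simp: free_pcomp_add_left)
  qed (simp_all add: free_pcomp_add_left free_pcomp_add_right free_pcomp_scale_left free_pcomp_scale_right scale_right_distrib scale_left_distrib)
qed


section \<open>Groebner bases\<close>

text \<open>
  \<open>occurs_at_root w v\<close>: the tree \<open>v\<close> contains a copy of \<open>w\<close> whose root is the root of \<open>v\<close>;
  the leaves of \<open>w\<close> may sit on any edges of \<open>v\<close>.
\<close>

inductive occurs_at_root :: "'g tree \<Rightarrow> 'g tree \<Rightarrow> bool" where
  Leaf: "occurs_at_root Leaf v"
| Node: "list_all2 occurs_at_root ws vs \<Longrightarrow> occurs_at_root (Node a ws) (Node a vs)"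

inductive tree_divides :: "'g tree \<Rightarrow> 'g tree \<Rightarrow> bool" where
  root: "occurs_at_root w v \<Longrightarrow> tree_divides w v"
| child: "\<lbrakk>v \<in> set vs; tree_divides w v\<rbrakk> \<Longrightarrow> tree_divides w (Node a vs)"

text \<open>
  An order is given by its reflexive relations: \<open>(s, t) \<in> ord n\<close> means that \<open>s\<close> is at most \<open>t\<close>
  among the tree monomials of arity \<open>n\<close>.
\<close>

definition admissible_order ::
  "'g set \<Rightarrow> ('g \<Rightarrow> nat) \<Rightarrow> (nat \<Rightarrow> ('g tree \<times> 'g tree) set) \<Rightarrow> bool" where
  "admissible_order U ar ord \<longleftrightarrow>
     (\<forall>n\<ge>1. well_order_on (tree_monomials U ar n) (ord n)) \<and>
     (\<forall>n m i s s' t. 1 \<le> i \<longrightarrow> i \<le> n \<longrightarrow> m \<ge> 1 \<longrightarrow>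
        (s, s') \<in> ord n - Id \<longrightarrow> t \<in> tree_monomials U ar m \<longrightarrow>
        (graft s i t, graft s' i t) \<in> ord (n + m - 1) - Id) \<and>
     (\<forall>n m i s t t'. 1 \<le> i \<longrightarrow> i \<le> n \<longrightarrow> m \<ge> 1 \<longrightarrow>
        s \<in> tree_monomials U ar n \<longrightarrow> (t, t') \<in> ord m - Id \<longrightarrow>
        (graft s i t, graft s i t') \<in> ord (n + m - 1) - Id)"

definition leading_monomial ::
  "(nat \<Rightarrow> ('g tree \<times> 'g tree) set) \<Rightarrow> nat \<Rightarrow> ('g tree \<Rightarrow>\<^sub>0 'k::field) \<Rightarrow> 'g tree" where
  "leading_monomial ord n f =
     (THE t. t \<in> Poly_Mapping.keys f \<and> (\<forall>s\<in>Poly_Mapping.keys f. (s, t) \<in> ord n))"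

text \<open>Only nonzero elements have a leading monomial, so zero elements of \<open>G\<close> are ignored.\<close>

definition groebner_basis ::
  "(nat \<Rightarrow> ('g tree \<times> 'g tree) set) \<Rightarrow> (nat \<Rightarrow> ('g tree \<Rightarrow>\<^sub>0 'k::field) set)
    \<Rightarrow> (nat \<times> ('g tree \<Rightarrow>\<^sub>0 'k)) set \<Rightarrow> bool" where
  "groebner_basis ord C G \<longleftrightarrow>
     G \<subseteq> Sigma {1..} C \<and>
     (\<forall>n\<ge>1. \<forall>f\<in>C n. f \<noteq> 0 \<longrightarrow>
        (\<exists>(m, g)\<in>G. g \<noteq> 0 \<and> tree_divides (leading_monomial ord m g) (leading_monomial ord n f)))"

end

theory Submission
  imports Defs
begin

text \<open>
  The leading monomials of the ideal are closed under grafting, so they are exactly the tree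
  monomials divisible by one of the finitely many leading monomials of the Groebner basis, and
  \<open>dim P(n)\<close> counts the \<open>n\<close>-ary trees avoiding these patterns.  Such trees are recognised by a
  finite bottom-up automaton.  Marking vertices by \<open>t\<close>, the series \<open>y\<^sub>\<sigma>\<close> of the states satisfy
  \<open>y\<^sub>\<sigma> = l\<^sub>\<sigma> + t \<Phi>\<^sub>\<sigma>(y)\<close>.  Perturbing this to \<open>y\<^sub>\<sigma> = l\<^sub>\<sigma> + t (\<Phi>\<^sub>\<sigma>(y) + \<epsilon> y\<^sub>\<sigma>\<^sup>d)\<close> with
  \<open>d > deg \<Phi>\<close>, every polynomial in the \<open>y\<^sub>\<sigma>\<close> becomes, up to powers of \<open>t \<epsilon>\<close>, a combination of the
  finitely many monomials with all exponents below \<open>d\<close>; hence powers of a given one are linearly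
  dependent and it is algebraic.  Cancelling factors \<open>\<epsilon>\<close> and \<open>t - 1\<close> one can then put \<open>\<epsilon> = 0\<close> and
  \<open>t = 1\<close>.  Power series are replaced by congruences between polynomial approximations: modulo \<open>t\<^sup>h\<close>
  at first, and, since there are finitely many normal trees of each arity, modulo \<open>z\<^sup>n\<close> in the end.
\<close>

section \<open>Elimination\<close>

text \<open>Fraction-free Gaussian elimination: a vector with nonzero coordinate \<open>j\<close>
  serves as pivot, and cross-multiplication clears this coordinate from the other vectors without
  division, so the relation has coefficients in the domain itself.\<close>

lemma linear_dependence_idom:
  fixes v :: "nat \<Rightarrow> 'j \<Rightarrow> 'a::idom"
  assumes "finite J" "finite K" "card J < card K"
  shows "\<exists>c. (\<exists>k\<in>K. c k \<noteq> 0) \<and> (\<forall>j\<in>J. (\<Sum>k\<in>K. c k * v k j) = 0)"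
  using assms
proof (induction J arbitrary: K v rule: finite_induct)
  case empty
  then have "K \<noteq> {}" by auto
  then show ?case by (intro exI[of _ "\<lambda>_. 1"]) auto
next
  case (insert j J)
  show ?case
  proof (cases "\<forall>k\<in>K. v k j = 0")
    case True
    moreover have "card J < card K" using insert by simp
    then obtain c where "\<exists>k\<in>K. c k \<noteq> 0" "\<forall>i\<in>J. (\<Sum>k\<in>K. c k * v k i) = 0"
      using insert.IH[of K v] insert.prems(1) by blast
    ultimately show ?thesis by (intro exI[of _ c]) simp
  next
    case False
    then obtain l where l: "l \<in> K" "v l j \<noteq> 0" by auto
    let ?K = "K - {l}"
    have "card J < card ?K" using insert l by simp
    then obtain c where c: "\<exists>k\<in>?K. c k \<noteq> 0"
      "\<forall>i\<in>J. (\<Sum>k\<in>?K. c k * (v l j * v k i - v k j * v l i)) = 0"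
      using insert.IH[of ?K "\<lambda>k i. v l j * v k i - v k j * v l i"] insert.prems by auto
    \<comment> \<open>The coefficient of the pivot \<open>l\<close> is chosen to undo the
      elimination; at coordinate \<open>j\<close> the resulting sum vanishes by
      commutativity.\<close>
    define c' where "c' = (\<lambda>k. if k = l then - (\<Sum>k\<in>?K. c k * v k j) else v l j * c k)"
    have "(\<Sum>k\<in>K. c' k * v k i) = (\<Sum>k\<in>?K. c k * (v l j * v k i - v k j * v l i))" for i
    proof -
      have "(\<Sum>k\<in>K. c' k * v k i) = c' l * v l i + (\<Sum>k\<in>?K. c' k * v k i)"
        using insert.prems(1) l(1) by (rule sum.remove)
      also have "\<dots> = - (\<Sum>k\<in>?K. c k * v k j) * v l i + (\<Sum>k\<in>?K. v l j * c k * v k i)"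
        by (simp add: c'_def)
      also have "\<dots> = (\<Sum>k\<in>?K. c k * (v l j * v k i - v k j * v l i))"
        by (simp add: sum_distrib_left sum_distrib_right sum_subtractf algebra_simps)
      finally show ?thesis .
    qed
    then have "\<forall>i\<in>insert j J. (\<Sum>k\<in>K. c' k * v k i) = 0" using c(2) by (auto simp: mult.commute)
    moreover have "\<exists>k\<in>K. c' k \<noteq> 0" using c(1) l by (auto simp: c'_def)
    ultimately show ?thesis by blast
  qed
qed

text \<open>Polynomials are represented by their evaluation functions, so that they can be applied
  directly to elements satisfying relations only modulo some \<open>m\<close>. The number
  \<open>n\<close> is an upper bound for the total degree, not its exact value.\<close>

inductive polyfun :: "'i set \<Rightarrow> nat \<Rightarrow> (('i \<Rightarrow> 'a::comm_ring_1) \<Rightarrow> 'a) \<Rightarrow> bool" for I n where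
  monomial: "sum \<beta> I \<le> n \<Longrightarrow> polyfun I n (\<lambda>y. c * (\<Prod>i\<in>I. y i ^ \<beta> i))"
| add: "polyfun I n p \<Longrightarrow> polyfun I n q \<Longrightarrow> polyfun I n (\<lambda>y. p y + q y)"

lemma polyfun_mono: "polyfun I n p \<Longrightarrow> n \<le> n' \<Longrightarrow> polyfun I n' p"
  by (induction rule: polyfun.induct) (auto intro: polyfun.intros)

lemma polyfun_const: "polyfun I n (\<lambda>y. c)"
  using polyfun.monomial[of "\<lambda>_. 0" I n c] by simp

lemma polyfun_var:
  fixes I :: "'i set"
  assumes "finite I" "i \<in> I" "n \<ge> 1"
  shows "polyfun I n (\<lambda>y. y i :: 'a::comm_ring_1)"
proof -
  have "(\<Prod>j\<in>I. y j ^ (if j = i then 1 else 0)) = y i" for y :: "'i \<Rightarrow> 'a"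
    using assms by (simp add: prod.remove[of I i])
  moreover have "(\<Sum>j\<in>I. if j = i then 1 else 0) \<le> n" using assms by simp
  ultimately show ?thesis using polyfun.monomial[of "\<lambda>j. if j = i then 1 else 0" I n "1::'a"] by simp
qed

lemma polyfun_mult:
  assumes "polyfun I n p" "polyfun I m q"
  shows "polyfun I (n + m) (\<lambda>y. p y * q y)"
  using assms(1)
proof (induction rule: polyfun.induct)
  case (monomial \<beta> c)
  show ?case using assms(2)
  proof (induction rule: polyfun.induct)
    case (monomial \<gamma> c')
    then show ?case
      using polyfun.monomial[of "\<lambda>i. \<beta> i + \<gamma> i" I "n + m" "c * c'"] \<open>sum \<beta> I \<le> n\<close>
      by (simp add: sum.distrib power_add prod.distrib mult_ac)
  next
    case (add p q)
    then show ?case using polyfun.add[OF add.IH] by (simp add: distrib_left)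
  qed
next
  case (add p q)
  then show ?case using polyfun.add[OF add.IH] by (simp add: distrib_right)
qed

lemma polyfun_scale: "polyfun I n p \<Longrightarrow> polyfun I n (\<lambda>y. c * p y)"
  using polyfun_mult[OF polyfun_const[of I 0 c]] by fastforce

lemma polyfun_diff: "polyfun I n p \<Longrightarrow> polyfun I n q \<Longrightarrow> polyfun I n (\<lambda>y. p y - q y)"
  using polyfun.add[of I n p "\<lambda>y. -1 * q y"] polyfun_scale[of I n q "-1"] by simp

lemma polyfun_power: "polyfun I n p \<Longrightarrow> polyfun I (n * k) (\<lambda>y. p y ^ k)"
  using polyfun_mult[of I n p "n * (k - 1)"]
  by (induction k) (auto simp: polyfun_const intro: polyfun_mult)

lemma polyfun_sum:
  "(\<And>x. x \<in> X \<Longrightarrow> polyfun I n (p x)) \<Longrightarrow> polyfun I n (\<lambda>y. \<Sum>x\<in>X. p x y)"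
  by (induction X rule: infinite_finite_induct) (auto intro: polyfun_const polyfun.add)

lemma polyfun_prod_list:
  assumes "finite I" "set xs \<subseteq> I"
  shows "polyfun I (length xs) (\<lambda>y. prod_list (map y xs))"
  using assms(2)
proof (induction xs)
  case (Cons x xs)
  then show ?case using polyfun_mult[OF polyfun_var[of I x 1], of "length xs"] assms(1) by simp
qed (simp add: polyfun_const)

section \<open>Congruences and polynomial functions\<close>

lemma dvd_power_diff: "(m::'a::comm_ring_1) dvd x - y \<Longrightarrow> m dvd x ^ k - y ^ k"
  by (metis dvd_mult2 power_diff_sumr2)

lemma dvd_mult_diff:
  assumes "(m::'a::comm_ring_1) dvd x - y" "m dvd x' - y'"
  shows "m dvd x * x' - y * y'"
proof -
  have "x * x' - y * y' = (x - y) * x' + y * (x' - y')" by (simp add: algebra_simps)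
  then show ?thesis using assms by simp
qed

lemma dvd_prod_diff:
  "(\<And>i. i \<in> I \<Longrightarrow> (m::'a::comm_ring_1) dvd f i - g i) \<Longrightarrow> m dvd prod f I - prod g I"
  by (induction I rule: infinite_finite_induct) (auto intro: dvd_mult_diff)

lemma polyfun_cong_dvd:
  assumes "polyfun I n p" "\<And>i. i \<in> I \<Longrightarrow> m dvd y i - y' i"
  shows "m dvd p y - p y'"
  using assms(1)
proof (induction rule: polyfun.induct)
  case (monomial \<beta> c)
  have "m dvd (\<Prod>i\<in>I. y i ^ \<beta> i) - (\<Prod>i\<in>I. y' i ^ \<beta> i)"
    by (intro dvd_prod_diff dvd_power_diff assms)
  then show ?case by (metis dvd_mult right_diff_distrib)
next
  case (add p q)
  then show ?case by (metis add_diff_add dvd_add)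
qed

text \<open>
  Modulo the relations \<open>e y\<^sub>i\<^sup>d = \<Psi>\<^sub>i(y)\<close>, some multiple \<open>e\<^sup>E p(y)\<close> is a combination of the
  monomials in which all exponents are less than \<open>d\<close>.  Stating this for all \<open>m\<close> and \<open>y\<close> at once keeps
  the coefficients independent of them.
\<close>

definition reducible ::
  "'i set \<Rightarrow> nat \<Rightarrow> 'a::comm_ring_1 \<Rightarrow> ('i \<Rightarrow> ('i \<Rightarrow> 'a) \<Rightarrow> 'a) \<Rightarrow> (('i \<Rightarrow> 'a) \<Rightarrow> 'a) \<Rightarrow> bool" where
  "reducible I d e \<Psi> p \<longleftrightarrow>
     (\<exists>E c. \<forall>m y. (\<forall>i\<in>I. m dvd e * y i ^ d - \<Psi> i y) \<longrightarrow>
        m dvd e ^ E * p y - (\<Sum>\<alpha>\<in>PiE I (\<lambda>_. {..<d}). c \<alpha> * (\<Prod>i\<in>I. y i ^ \<alpha> i)))"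

lemma reducibleI:
  "(\<And>m y. (\<And>i. i \<in> I \<Longrightarrow> m dvd e * y i ^ d - \<Psi> i y) \<Longrightarrow>
     m dvd e ^ E * p y - (\<Sum>\<alpha>\<in>PiE I (\<lambda>_. {..<d}). c \<alpha> * (\<Prod>i\<in>I. y i ^ \<alpha> i)))
   \<Longrightarrow> reducible I d e \<Psi> p"
  unfolding reducible_def by blast

text \<open>Multiplying a reduction by a further power of \<open>e\<close> gives another one. So all
  large exponents are available, and several reductions can be brought to a common exponent.\<close>

lemma reducible_exponent:
  assumes "reducible I d e \<Psi> p"
  obtains E where "\<And>E'. E' \<ge> E \<Longrightarrow> \<exists>c. \<forall>m y. (\<forall>i\<in>I. m dvd e * y i ^ d - \<Psi> i y) \<longrightarrow>
        m dvd e ^ E' * p y - (\<Sum>\<alpha>\<in>PiE I (\<lambda>_. {..<d}). c \<alpha> * (\<Prod>i\<in>I. y i ^ \<alpha> i))"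
proof -
  let ?J = "PiE I (\<lambda>_. {..<d})"
  obtain E c where c: "\<And>m y. (\<forall>i\<in>I. m dvd e * y i ^ d - \<Psi> i y) \<Longrightarrow>
        m dvd e ^ E * p y - (\<Sum>\<alpha>\<in>?J. c \<alpha> * (\<Prod>i\<in>I. y i ^ \<alpha> i))"
    using assms unfolding reducible_def by blast
  have "\<exists>c. \<forall>m y. (\<forall>i\<in>I. m dvd e * y i ^ d - \<Psi> i y) \<longrightarrow>
        m dvd e ^ E' * p y - (\<Sum>\<alpha>\<in>?J. c \<alpha> * (\<Prod>i\<in>I. y i ^ \<alpha> i))" if "E' \<ge> E" for E'
  proof (rule exI[of _ "\<lambda>\<alpha>. e ^ (E' - E) * c \<alpha>"], intro allI impI)
    fix m y assume "\<forall>i\<in>I. m dvd e * y i ^ d - \<Psi> i y"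
    then have "m dvd e ^ (E' - E) * (e ^ E * p y - (\<Sum>\<alpha>\<in>?J. c \<alpha> * (\<Prod>i\<in>I. y i ^ \<alpha> i)))"
      by (intro dvd_mult c)
    moreover have "e ^ (E' - E) * (e ^ E * p y) = e ^ E' * p y"
      using that by (simp add: mult.assoc[symmetric] power_add[symmetric])
    ultimately show "m dvd e ^ E' * p y - (\<Sum>\<alpha>\<in>?J. e ^ (E' - E) * c \<alpha> * (\<Prod>i\<in>I. y i ^ \<alpha> i))"
      by (simp add: right_diff_distrib sum_distrib_left mult.assoc)
  qed
  then show ?thesis using that by blast
qed

lemma reducible_add:
  assumes "reducible I d e \<Psi> p" "reducible I d e \<Psi> q"
  shows "reducible I d e \<Psi> (\<lambda>y. p y + q y)"
proof -
  let ?J = "PiE I (\<lambda>_. {..<d})"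
  obtain E1 where E1: "\<And>E'. E' \<ge> E1 \<Longrightarrow> \<exists>c. \<forall>m y. (\<forall>i\<in>I. m dvd e * y i ^ d - \<Psi> i y) \<longrightarrow>
        m dvd e ^ E' * p y - (\<Sum>\<alpha>\<in>?J. c \<alpha> * (\<Prod>i\<in>I. y i ^ \<alpha> i))"
    using reducible_exponent[OF assms(1)] by blast
  obtain E2 where E2: "\<And>E'. E' \<ge> E2 \<Longrightarrow> \<exists>c. \<forall>m y. (\<forall>i\<in>I. m dvd e * y i ^ d - \<Psi> i y) \<longrightarrow>
        m dvd e ^ E' * q y - (\<Sum>\<alpha>\<in>?J. c \<alpha> * (\<Prod>i\<in>I. y i ^ \<alpha> i))"
    using reducible_exponent[OF assms(2)] by blast
  let ?E = "max E1 E2"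
  obtain c1 c2 where
    "\<And>m y. (\<forall>i\<in>I. m dvd e * y i ^ d - \<Psi> i y) \<Longrightarrow>
        m dvd e ^ ?E * p y - (\<Sum>\<alpha>\<in>?J. c1 \<alpha> * (\<Prod>i\<in>I. y i ^ \<alpha> i))"
    "\<And>m y. (\<forall>i\<in>I. m dvd e * y i ^ d - \<Psi> i y) \<Longrightarrow>
        m dvd e ^ ?E * q y - (\<Sum>\<alpha>\<in>?J. c2 \<alpha> * (\<Prod>i\<in>I. y i ^ \<alpha> i))"
    using E1[of ?E] E2[of ?E] by auto
  note c = this
  show ?thesis
  proof (rule reducibleI[where E = ?E and c = "\<lambda>\<alpha>. c1 \<alpha> + c2 \<alpha>"])
    fix m y assume "\<And>i. i \<in> I \<Longrightarrow> m dvd e * y i ^ d - \<Psi> i y"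
    then have "m dvd (e ^ ?E * p y - (\<Sum>\<alpha>\<in>?J. c1 \<alpha> * (\<Prod>i\<in>I. y i ^ \<alpha> i)))
       + (e ^ ?E * q y - (\<Sum>\<alpha>\<in>?J. c2 \<alpha> * (\<Prod>i\<in>I. y i ^ \<alpha> i)))"
      by (intro dvd_add c) auto
    then show "m dvd e ^ ?E * (p y + q y) - (\<Sum>\<alpha>\<in>?J. (c1 \<alpha> + c2 \<alpha>) * (\<Prod>i\<in>I. y i ^ \<alpha> i))"
      by (simp add: algebra_simps sum.distrib)
  qed
qed

lemma reducible_scale:
  assumes "reducible I d e \<Psi> p"
  shows "reducible I d e \<Psi> (\<lambda>y. a * p y)"
proof -
  let ?J = "PiE I (\<lambda>_. {..<d})"
  obtain E c where c: "\<And>m y. (\<forall>i\<in>I. m dvd e * y i ^ d - \<Psi> i y) \<Longrightarrow>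
        m dvd e ^ E * p y - (\<Sum>\<alpha>\<in>?J. c \<alpha> * (\<Prod>i\<in>I. y i ^ \<alpha> i))"
    using assms unfolding reducible_def by blast
  show ?thesis
  proof (rule reducibleI[where E = E and c = "\<lambda>\<alpha>. a * c \<alpha>"])
    fix m y assume "\<And>i. i \<in> I \<Longrightarrow> m dvd e * y i ^ d - \<Psi> i y"
    then have "m dvd a * (e ^ E * p y - (\<Sum>\<alpha>\<in>?J. c \<alpha> * (\<Prod>i\<in>I. y i ^ \<alpha> i)))"
      by (intro dvd_mult c) auto
    then show "m dvd e ^ E * (a * p y) - (\<Sum>\<alpha>\<in>?J. a * c \<alpha> * (\<Prod>i\<in>I. y i ^ \<alpha> i))"
      by (simp add: right_diff_distrib sum_distrib_left mult_ac)
  qed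
qed

text \<open>Rewriting \<open>e * p\<close> to \<open>q\<close> modulo the relations costs one more
  factor \<open>e\<close>, hence the exponent \<open>Suc E\<close>.\<close>

lemma reducible_step:
  assumes "reducible I d e \<Psi> q"
    and "\<And>m y. (\<And>i. i \<in> I \<Longrightarrow> m dvd e * y i ^ d - \<Psi> i y) \<Longrightarrow> m dvd e * p y - q y"
  shows "reducible I d e \<Psi> p"
proof -
  let ?J = "PiE I (\<lambda>_. {..<d})"
  obtain E c where c: "\<And>m y. (\<forall>i\<in>I. m dvd e * y i ^ d - \<Psi> i y) \<Longrightarrow>
        m dvd e ^ E * q y - (\<Sum>\<alpha>\<in>?J. c \<alpha> * (\<Prod>i\<in>I. y i ^ \<alpha> i))"
    using assms(1) unfolding reducible_def by blast
  show ?thesis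
  proof (rule reducibleI[where E = "Suc E" and c = c])
    fix m y assume r: "\<And>i. i \<in> I \<Longrightarrow> m dvd e * y i ^ d - \<Psi> i y"
    have "m dvd e ^ E * (e * p y - q y)
        + (e ^ E * q y - (\<Sum>\<alpha>\<in>?J. c \<alpha> * (\<Prod>i\<in>I. y i ^ \<alpha> i)))"
      using r by (intro dvd_add dvd_mult assms(2) c) auto
    then show "m dvd e ^ Suc E * p y - (\<Sum>\<alpha>\<in>?J. c \<alpha> * (\<Prod>i\<in>I. y i ^ \<alpha> i))"
      by (simp add: algebra_simps)
  qed
qed

text \<open>Induction on the total degree: if some exponent is at least \<open>d\<close>, then
  \<open>y i ^ d\<close> can be traded, at the price of one factor \<open>e\<close>, for
  \<open>\<Psi> i y\<close> of degree at most \<open>d - 1\<close>, so the total degree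
  drops.\<close>

lemma reducible_polyfun:
  fixes e :: "'a::comm_ring_1" and I :: "'i set"
  assumes I: "finite I" and d: "d > 0"
    and \<Psi>: "\<And>i. i \<in> I \<Longrightarrow> polyfun I (d - 1) (\<Psi> i)"
    and p: "polyfun I n p"
  shows "reducible I d e \<Psi> p"
proof -
  let ?J = "PiE I (\<lambda>_. {..<d})"
  have mono: "reducible I d e \<Psi> (\<lambda>y. \<Prod>i\<in>I. y i ^ \<beta> i)" for \<beta>
  proof (induction "sum \<beta> I" arbitrary: \<beta> rule: less_induct)
    case less
    \<comment> \<open>Linearity extends the induction hypothesis from monomials to all polynomials
      of smaller degree.\<close>
    have poly: "reducible I d e \<Psi> q" if "polyfun I k q" "k < sum \<beta> I" for k q
      using that
    proof (induction rule: polyfun.induct)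
      case (monomial \<gamma> c)
      then show ?case by (intro reducible_scale less) auto
    qed (auto intro: reducible_add)
    show ?case
    proof (cases "\<forall>i\<in>I. \<beta> i < d")
      case True
      \<comment> \<open>The monomial is already reduced, with an indicator function as coefficients.
        Elements of \<open>PiE\<close> have a fixed value outside \<open>I\<close>, hence
        \<open>restrict\<close>.\<close>
      then have J: "restrict \<beta> I \<in> ?J" by auto
      have fin: "finite ?J" using I by (auto intro: finite_PiE)
      show ?thesis
      proof (rule reducibleI[where E = 0 and c = "\<lambda>\<alpha>. if \<alpha> = restrict \<beta> I then 1 else 0"])
        fix m and y :: "'i \<Rightarrow> 'a"
        have "(\<Sum>\<alpha>\<in>?J. (if \<alpha> = restrict \<beta> I then 1 else 0) * (\<Prod>i\<in>I. y i ^ \<alpha> i))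
           = (\<Sum>\<alpha>\<in>?J. if \<alpha> = restrict \<beta> I then (\<Prod>i\<in>I. y i ^ \<alpha> i) else 0)"
          by (intro sum.cong) auto
        also have "\<dots> = (\<Prod>i\<in>I. y i ^ \<beta> i)" using J fin by simp
        finally show "m dvd e ^ 0 * (\<Prod>i\<in>I. y i ^ \<beta> i)
            - (\<Sum>\<alpha>\<in>?J. (if \<alpha> = restrict \<beta> I then 1 else 0) * (\<Prod>i\<in>I. y i ^ \<alpha> i))"
          by simp
      qed
    next
      case False
      then obtain i where i: "i \<in> I" "\<beta> i \<ge> d" by auto
      define \<gamma> where "\<gamma> = \<beta>(i := \<beta> i - d)"
      have \<beta>: "(\<Prod>j\<in>I. y j ^ \<beta> j) = y i ^ d * (\<Prod>j\<in>I. y j ^ \<gamma> j)" for y :: "'i \<Rightarrow> 'a"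
      proof -
        have "y i ^ \<beta> i = y i ^ d * y i ^ \<gamma> i"
          using i by (simp add: \<gamma>_def power_add[symmetric])
        moreover have "(\<Prod>j\<in>I - {i}. y j ^ \<beta> j) = (\<Prod>j\<in>I - {i}. y j ^ \<gamma> j)"
          by (intro prod.cong) (auto simp: \<gamma>_def)
        ultimately show ?thesis by (simp add: prod.remove[OF I i(1)] mult.assoc)
      qed
      have "sum \<beta> I = sum \<gamma> I + d"
      proof -
        have "sum \<beta> (I - {i}) = sum \<gamma> (I - {i})" by (intro sum.cong) (auto simp: \<gamma>_def)
        then show ?thesis using sum.remove[OF I i(1), of \<beta>] sum.remove[OF I i(1), of \<gamma>] i
          by (simp add: \<gamma>_def)
      qed
      moreover have "polyfun I (d - 1 + sum \<gamma> I) (\<lambda>y. \<Psi> i y * (1 * (\<Prod>j\<in>I. y j ^ \<gamma> j)))"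
        by (intro polyfun_mult \<Psi> i polyfun.monomial) simp
      ultimately have "reducible I d e \<Psi> (\<lambda>y. \<Psi> i y * (1 * (\<Prod>j\<in>I. y j ^ \<gamma> j)))"
        using d by (intro poly) auto
      then show ?thesis
      proof (rule reducible_step)
        fix m y assume "\<And>i. i \<in> I \<Longrightarrow> m dvd e * y i ^ d - \<Psi> i y"
        then have "m dvd (e * y i ^ d - \<Psi> i y) * (\<Prod>j\<in>I. y j ^ \<gamma> j)" using i by simp
        then show "m dvd e * (\<Prod>j\<in>I. y j ^ \<beta> j) - \<Psi> i y * (1 * (\<Prod>j\<in>I. y j ^ \<gamma> j))"
          by (simp add: \<beta> algebra_simps)
      qed
    qed
  qed
  show ?thesis using p by (induction rule: polyfun.induct) (auto intro: reducible_add reducible_scale mono)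
qed

text \<open>After multiplication by a common power of \<open>e\<close>, all powers of
  \<open>p\<close> reduce to combinations of the same finitely many monomials. Taking one power more
  than there are such monomials forces a linear relation, which is \<open>Q\<close>. It is fixed
  before \<open>m\<close> and \<open>y\<close>, so one \<open>Q\<close> serves all
  approximations.\<close>

lemma elimination:
  fixes e :: "'a::idom"
  assumes I: "finite I" and d: "d > 0" and e: "e \<noteq> 0"
    and \<Psi>: "\<And>i. i \<in> I \<Longrightarrow> polyfun I (d - 1) (\<Psi> i)"
    and p: "polyfun I n p"
  obtains Q where "Q \<noteq> 0"
    "\<And>m y. \<forall>i\<in>I. m dvd e * y i ^ d - \<Psi> i y \<Longrightarrow> m dvd poly Q (p y)"
proof -
  let ?J = "PiE I (\<lambda>_. {..<d})"
  have J: "finite ?J" using I by (auto intro: finite_PiE)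
  let ?K = "{..card ?J}"
  have "\<forall>k. \<exists>E. \<forall>E'\<ge>E. \<exists>c. \<forall>m y. (\<forall>i\<in>I. m dvd e * y i ^ d - \<Psi> i y) \<longrightarrow>
        m dvd e ^ E' * p y ^ k - (\<Sum>\<alpha>\<in>?J. c \<alpha> * (\<Prod>i\<in>I. y i ^ \<alpha> i))"
  proof
    fix k
    have "reducible I d e \<Psi> (\<lambda>y. p y ^ k)"
      by (rule reducible_polyfun[OF I d \<Psi> polyfun_power[OF p]])
    then obtain E where "\<And>E'. E' \<ge> E \<Longrightarrow> \<exists>c. \<forall>m y. (\<forall>i\<in>I. m dvd e * y i ^ d - \<Psi> i y) \<longrightarrow>
        m dvd e ^ E' * p y ^ k - (\<Sum>\<alpha>\<in>?J. c \<alpha> * (\<Prod>i\<in>I. y i ^ \<alpha> i))"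
      by (rule reducible_exponent) blast
    then show "\<exists>E. \<forall>E'\<ge>E. \<exists>c. \<forall>m y. (\<forall>i\<in>I. m dvd e * y i ^ d - \<Psi> i y) \<longrightarrow>
        m dvd e ^ E' * p y ^ k - (\<Sum>\<alpha>\<in>?J. c \<alpha> * (\<Prod>i\<in>I. y i ^ \<alpha> i))" by blast
  qed
  from choice[OF this] obtain E where E: "\<And>k E'. E' \<ge> E k \<Longrightarrow> \<exists>c. \<forall>m y. (\<forall>i\<in>I. m dvd e * y i ^ d - \<Psi> i y) \<longrightarrow>
        m dvd e ^ E' * p y ^ k - (\<Sum>\<alpha>\<in>?J. c \<alpha> * (\<Prod>i\<in>I. y i ^ \<alpha> i))"
    by blast
  define B where "B = Max (E ` ?K)"
  have "B \<ge> E k" if "k \<in> ?K" for k using that unfolding B_def by (intro Max_ge) auto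
  then have "\<forall>k\<in>?K. \<exists>c. \<forall>m y. (\<forall>i\<in>I. m dvd e * y i ^ d - \<Psi> i y) \<longrightarrow>
        m dvd e ^ B * p y ^ k - (\<Sum>\<alpha>\<in>?J. c \<alpha> * (\<Prod>i\<in>I. y i ^ \<alpha> i))"
    using E by blast
  from bchoice[OF this] obtain c where c: "\<And>k m y. k \<in> ?K \<Longrightarrow> \<forall>i\<in>I. m dvd e * y i ^ d - \<Psi> i y \<Longrightarrow>
        m dvd e ^ B * p y ^ k - (\<Sum>\<alpha>\<in>?J. c k \<alpha> * (\<Prod>i\<in>I. y i ^ \<alpha> i))"
    by blast
  obtain l where l: "\<exists>k\<in>?K. l k \<noteq> 0" "\<forall>\<alpha>\<in>?J. (\<Sum>k\<in>?K. l k * c k \<alpha>) = 0"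
    using linear_dependence_idom[OF J, of ?K c] by auto
  define Q where "Q = (\<Sum>k\<in>?K. monom (l k * e ^ B) k)"
  have "coeff Q k = (if k \<in> ?K then l k * e ^ B else 0)" for k
    unfolding Q_def coeff_sum coeff_monom by (subst sum.delta) auto
  then have "Q \<noteq> 0" using l(1) e by (metis coeff_0 no_zero_divisors power_not_zero)
  moreover have "m dvd poly Q (p y)" if r: "\<forall>i\<in>I. m dvd e * y i ^ d - \<Psi> i y" for m y
  proof -
    have "m dvd (\<Sum>k\<in>?K. l k * (e ^ B * p y ^ k - (\<Sum>\<alpha>\<in>?J. c k \<alpha> * (\<Prod>i\<in>I. y i ^ \<alpha> i))))"
      using r by (intro dvd_sum dvd_mult c) auto
    also have "\<dots> = poly Q (p y) - (\<Sum>k\<in>?K. \<Sum>\<alpha>\<in>?J. l k * c k \<alpha> * (\<Prod>i\<in>I. y i ^ \<alpha> i))"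
      by (simp add: Q_def poly_sum poly_monom right_diff_distrib sum_subtractf sum_distrib_left mult.assoc)
    also have "(\<Sum>k\<in>?K. \<Sum>\<alpha>\<in>?J. l k * c k \<alpha> * (\<Prod>i\<in>I. y i ^ \<alpha> i))
        = (\<Sum>\<alpha>\<in>?J. (\<Sum>k\<in>?K. l k * c k \<alpha>) * (\<Prod>i\<in>I. y i ^ \<alpha> i))"
      by (subst sum.swap) (simp add: sum_distrib_right)
    also have "\<dots> = 0" using l(2) by simp
    finally show ?thesis by simp
  qed
  ultimately show ?thesis using that by blast
qed

section \<open>Substituting a value for a parameter\<close>

lemma const_dvd_mult_linear:
  fixes p :: "'a::idom poly"
  assumes "[:m:] dvd [:- a, 1:] * p"
  shows "[:m:] dvd p"
proof -
  have c: "m dvd coeff p k - a * coeff p (Suc k)" for k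
    using assms[unfolded const_poly_dvd_iff, rule_format, of "Suc k"] by (simp add: algebra_simps)
  \<comment> \<open>The factor \<open>[:- a, 1:]\<close> is monic, so \<open>c\<close> passes
    divisibility from each coefficient to the next lower one; the descent starts above the degree,
    where coefficients vanish.\<close>
  have "m dvd coeff p k" for k
  proof (induction "Suc (degree p) - k" arbitrary: k)
    case 0
    then show ?case by (simp add: coeff_eq_0)
  next
    case (Suc j)
    then have "m dvd a * coeff p (Suc k)" by auto
    then show ?case using dvd_add[OF c[of k]] by fastforce
  qed
  then show ?thesis by (simp add: const_poly_dvd_iff)
qed

lemma poly_map_poly_eval: "poly (map_poly (\<lambda>p. poly p a) Q) (poly y a) = poly (poly Q y) a"
  by (induction Q) (auto simp: map_poly_pCons)

text \<open>
  The common factors \<open>x - a\<close> of the coefficients have to be divided out before \<open>x = a\<close> may be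
  substituted; dividing by them is harmless modulo the constants \<open>m\<close>.
\<close>

lemma specialization:
  fixes Q :: "'a::idom poly poly"
  assumes "Q \<noteq> 0"
  obtains R where "R \<noteq> 0" "\<And>m y. [:m:] dvd poly Q y \<Longrightarrow> m dvd poly R (poly y a)"
proof -
  obtain k where "coeff Q k \<noteq> 0" using assms by (metis leading_coeff_0_iff)
  \<comment> \<open>The measure is the degree of one fixed nonzero coefficient, which each division
    by \<open>[:- a, 1:]\<close> lowers by one.\<close>
  then have "\<exists>R. R \<noteq> 0 \<and> (\<forall>m y. [:m:] dvd poly Q y \<longrightarrow> m dvd poly R (poly y a))"
  proof (induction "degree (coeff Q k)" arbitrary: Q rule: less_induct)
    case less
    let ?R = "map_poly (\<lambda>p. poly p a) Q"
    show ?case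
    proof (cases "?R = 0")
      case False
      have "m dvd poly ?R (poly y a)" if "[:m:] dvd poly Q y" for m y
        using that unfolding poly_map_poly_eval by (auto elim!: dvdE)
      then show ?thesis using False by blast
    next
      case True
      then have "\<forall>j. poly (coeff Q j) a = 0" by (metis coeff_0 coeff_map_poly poly_0)
      then have "[:[:- a, 1:]:] dvd Q" by (simp add: const_poly_dvd_iff poly_eq_0_iff_dvd)
      then obtain Q' where Q': "Q = smult [:- a, 1:] Q'" by (auto elim!: dvdE)
      then have Qk: "coeff Q k = [:- a, 1:] * coeff Q' k" by simp
      then have k: "coeff Q' k \<noteq> 0" using less.prems by auto
      then have "degree ([:- a, 1:] * coeff Q' k) = 1 + degree (coeff Q' k)"
        by (subst degree_mult_eq) auto
      then have "degree (coeff Q' k) < degree (coeff Q k)" by (simp only: Qk)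
      from less.hyps[OF this k] obtain R where
        "R \<noteq> 0" "\<And>m y. [:m:] dvd poly Q' y \<Longrightarrow> m dvd poly R (poly y a)" by blast
      moreover have "[:m:] dvd poly Q' y" if "[:m:] dvd poly Q y" for m y
        using that const_dvd_mult_linear[of m a] by (simp only: Q' poly_smult)
      ultimately show ?thesis by blast
    qed
  qed
  then show ?thesis using that by blast
qed

section \<open>Regular tree languages\<close>

lemma poly_dvd_diff:
  assumes "(m::'a::comm_ring_1) dvd x - y"
  shows "m dvd poly Q x - poly Q y"
proof (induction Q)
  case (pCons c Q)
  have "poly (pCons c Q) x - poly (pCons c Q) y = x * poly Q x - y * poly Q y" by simp
  then show ?case using dvd_mult_diff[OF assms pCons.IH] by simp
qed simp

lemma fps_X_power_dvd_iff: "fps_X ^ n dvd (f :: 'a::comm_ring_1 fps) \<longleftrightarrow> (\<forall>k<n. fps_nth f k = 0)"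
proof
  assume "\<forall>k<n. fps_nth f k = 0"
  then have "f = fps_X ^ n * fps_shift n f"
    by (auto simp: fps_eq_iff fps_X_power_mult_nth)
  then show "fps_X ^ n dvd f" by (rule dvdI)
qed (auto simp: fps_X_power_mult_nth elim!: dvdE)

text \<open>The inner variable marks leaves, the outer one marks vertices.\<close>

fun tree_weight :: "'g tree \<Rightarrow> rat poly poly" where
  "tree_weight Leaf = [:monom 1 1:]"
| "tree_weight (Node a ts) = [:0, 1:] * prod_list (map tree_weight ts)"

text \<open>The exponent \<open>k\<close> is the number of vertices. What counts is that the weight
  is a single monomial: setting the vertex variable to \<open>1\<close> leaves a power of the leaf
  variable.\<close>

lemma tree_weight_eq: "\<exists>k. tree_weight s = smult (monom 1 (leaves s)) ([:0, 1:] ^ k)"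
proof (induction s)
  case Leaf
  show ?case by (rule exI[of _ 0]) simp
next
  case (Node a ts)
  have "\<exists>k. prod_list (map tree_weight ts) = smult (monom 1 (sum_list (map leaves ts))) ([:0, 1:] ^ k)"
    using Node
  proof (induction ts)
    case Nil
    show ?case by (rule exI[of _ 0]) (simp add: monom_0 one_pCons)
  next
    case (Cons t ts)
    then obtain k where "prod_list (map tree_weight ts) = smult (monom 1 (sum_list (map leaves ts))) ([:0, 1:] ^ k)"
      by auto
    moreover obtain l where "tree_weight t = smult (monom 1 (leaves t)) ([:0, 1:] ^ l)"
      using Cons.prems by auto
    ultimately show ?case
      by (intro exI[of _ "l + k"]) (simp add: power_add mult_monom smult_smult mult.commute)
  qed
  then obtain k where "prod_list (map tree_weight ts) = smult (monom 1 (sum_list (map leaves ts))) ([:0, 1:] ^ k)"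
    by blast
  then show ?case by (intro exI[of _ "Suc k"]) simp
qed

lemma poly_tree_weight: "poly (tree_weight s) 1 = monom 1 (leaves s)"
  using tree_weight_eq[of s] by auto

lemma monom_dvd_tree_weight: "n \<le> leaves s \<Longrightarrow> [:monom 1 n:] dvd tree_weight s"
proof -
  assume "n \<le> leaves s"
  then have "(monom 1 n :: rat poly) dvd monom 1 (leaves s)" by (simp add: monom_1_dvd_iff')
  moreover obtain k where "tree_weight s = smult (monom 1 (leaves s)) ([:0, 1:] ^ k)"
    using tree_weight_eq by blast
  ultimately show ?thesis unfolding const_poly_dvd_iff by simp
qed

text \<open>A list of trees with a prescribed word of states is an independent choice of one tree
  from each fibre of \<open>st\<close>, so the sum factors by distributivity.\<close>

lemma sum_prod_list_map:
  fixes w :: "'t \<Rightarrow> 'a::comm_semiring_1"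
  assumes "finite N"
  shows "(\<Sum>ts | set ts \<subseteq> N \<and> map st ts = \<sigma>s. prod_list (map w ts))
    = prod_list (map (\<lambda>\<sigma>. \<Sum>s | s \<in> N \<and> st s = \<sigma>. w s) \<sigma>s)"
proof (induction \<sigma>s)
  case Nil
  have "{ts. set ts \<subseteq> N \<and> map st ts = []} = {[]}" by auto
  then show ?case by simp
next
  case (Cons \<sigma> \<sigma>s)
  have "{ts. set ts \<subseteq> N \<and> map st ts = \<sigma> # \<sigma>s}
    = (\<lambda>(s, ts). s # ts) ` ({s \<in> N. st s = \<sigma>} \<times> {ts. set ts \<subseteq> N \<and> map st ts = \<sigma>s})"
    by (auto simp: image_iff Cons_eq_map_conv map_eq_Cons_conv)
  moreover have "inj_on (\<lambda>(s, ts). s # ts) X" for X :: "('t \<times> 't list) set" by (auto simp: inj_on_def)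
  ultimately show ?case
    by (simp add: sum.reindex Cons.IH[symmetric] sum_product sum.cartesian_product split_def)
qed

text \<open>
  A deterministic bottom-up tree automaton: \<open>st\<close> is the state reached at the root, and a tree is
  accepted if the states at all its vertices and leaves lie in \<open>S\<close>; \<open>accepted h\<close> are those of height
  less than \<open>h\<close>.
\<close>

locale tree_automaton =
  fixes U :: "'g set" and ar :: "'g \<Rightarrow> nat" and st :: "'g tree \<Rightarrow> 's"
    and \<delta> :: "'g \<Rightarrow> 's list \<Rightarrow> 's" and S :: "'s set"
  assumes finite_U: "finite U" and finite_S: "finite S"
    and st_Node: "length ts = ar a \<Longrightarrow> st (Node a ts) = \<delta> a (map st ts)"
begin

primrec accepted :: "nat \<Rightarrow> 'g tree set" where
  "accepted 0 = {}"
| "accepted (Suc h) = {s. st s \<in> S \<and>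
     (s = Leaf \<or> (\<exists>a ts. s = Node a ts \<and> a \<in> U \<and> length ts = ar a \<and> set ts \<subseteq> accepted h))}"

definition transitions :: "'g \<Rightarrow> 's \<Rightarrow> 's list set" where
  "transitions a \<sigma> = {\<sigma>s. set \<sigma>s \<subseteq> S \<and> length \<sigma>s = ar a \<and> \<delta> a \<sigma>s = \<sigma>}"

text \<open>These are the polynomials \<open>\<Phi>\<^sub>\<sigma>\<close> of the equations above.
  The ring is left open because they are evaluated both over a domain and over polynomials in
  \<epsilon> with coefficients there.\<close>

definition system :: "('s \<Rightarrow> 'a::comm_ring_1) \<Rightarrow> 's \<Rightarrow> 'a" where
  "system y \<sigma> = (\<Sum>a\<in>U. \<Sum>\<sigma>s\<in>transitions a \<sigma>. prod_list (map y \<sigma>s))"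

lemma finite_transitions: "finite (transitions a \<sigma>)"
  by (rule finite_subset[OF _ finite_lists_length_eq[OF finite_S, of "ar a"]])
     (auto simp: transitions_def)

lemma accepted_state: "s \<in> accepted h \<Longrightarrow> st s \<in> S"
  by (cases h) auto

lemma accepted_Suc: "accepted h \<subseteq> accepted (Suc h)"
proof (induction h)
  case (Suc h)
  show ?case
  proof
    fix s assume "s \<in> accepted (Suc h)"
    then show "s \<in> accepted (Suc (Suc h))"
      using Suc unfolding accepted.simps(2)[of "Suc h"] accepted.simps(2)[of h] by blast
  qed
qed simp

lemma accepted_mono: "h \<le> h' \<Longrightarrow> accepted h \<subseteq> accepted h'"
  by (rule lift_Suc_mono_le[where f = accepted]) (rule accepted_Suc)

lemma finite_subset_accepted: "finite X \<Longrightarrow> X \<subseteq> (\<Union>h. accepted h) \<Longrightarrow> \<exists>H. X \<subseteq> accepted H"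
proof (induction X rule: finite_induct)
  case (insert s X)
  then obtain H h where "X \<subseteq> accepted H" "s \<in> accepted h" by auto
  then have "insert s X \<subseteq> accepted (max H h)"
    using accepted_mono[of H "max H h"] accepted_mono[of h "max H h"] by auto
  then show ?case ..
qed simp

lemma finite_accepted: "finite (accepted h)"
proof (induction h)
  case (Suc h)
  let ?X = "Sigma U (\<lambda>a. {ts. set ts \<subseteq> accepted h \<and> length ts = ar a})"
  have "finite ?X" using Suc finite_U by (auto intro: finite_lists_length_eq)
  moreover have "accepted (Suc h) \<subseteq> insert Leaf ((\<lambda>(a, ts). Node a ts) ` ?X)" by force
  ultimately show ?case by (meson finite_imageI finite_insert finite_subset)
qed simp

lemma system_cong: "(\<And>\<tau>. \<tau> \<in> S \<Longrightarrow> y \<tau> = y' \<tau>) \<Longrightarrow> system y \<sigma> = system y' \<sigma>"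
  unfolding system_def
  by (intro sum.cong refl arg_cong[where f = prod_list] map_cong) (auto simp: transitions_def)

lemma poly_system: "poly (system y \<sigma>) x = system (\<lambda>\<tau>. poly (y \<tau>) x) \<sigma>"
proof -
  have "poly (prod_list ps) x = prod_list (map (\<lambda>p. poly p x) ps)" for ps
    using poly_prod_list[of ps x] by simp
  then show ?thesis by (simp add: system_def poly_sum comp_def)
qed

lemma polyfun_system: "polyfun S (sum ar U) (\<lambda>y. system y \<sigma>)"
  unfolding system_def
proof (intro polyfun_sum)
  fix a \<sigma>s assume "a \<in> U" "\<sigma>s \<in> transitions a \<sigma>"
  then have "polyfun S (length \<sigma>s) (\<lambda>y. prod_list (map y \<sigma>s))" "length \<sigma>s \<le> sum ar U"
    using finite_S finite_U polyfun_prod_list[of S \<sigma>s]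
    by (auto simp: transitions_def intro: member_le_sum)
  then show "polyfun S (sum ar U) (\<lambda>y. prod_list (map y \<sigma>s))" by (rule polyfun_mono)
qed

text \<open>
  Adding \<open>t \<epsilon> y\<^sup>d\<close> with \<open>d\<close> larger than all other degrees to the equations makes the system
  zero-dimensional, so that the unknowns can be eliminated; then \<open>\<epsilon> = 0\<close> is substituted.
\<close>

lemma system_iterates_annihilated:
  fixes t :: "'a::idom"
  assumes t: "t \<noteq> 0"
    and F0: "\<And>\<sigma>. \<sigma> \<in> S \<Longrightarrow> F 0 \<sigma> = 0"
    and F_Suc: "\<And>h \<sigma>. \<sigma> \<in> S \<Longrightarrow> F (Suc h) \<sigma> = l \<sigma> + t * system (F h) \<sigma>"
  obtains Q where "Q \<noteq> 0" "\<And>h. t ^ h dvd poly Q (\<Sum>\<sigma>\<in>S. F h \<sigma>)"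
proof -
  \<comment> \<open>The bound \<open>d - 1\<close> has to accommodate both \<open>system\<close> and
    a linear term \<open>y \<sigma>\<close>, even when \<open>sum ar U = 0\<close>.\<close>
  define d where "d = sum ar U + 2"
  \<comment> \<open>Iterates of the perturbed system, as polynomials in the variable \<epsilon>,
    which is \<open>[:0, 1:]\<close>; at \<epsilon> = 0 they become the iterates
    \<open>F h\<close>.\<close>
  define Y where "Y = rec_nat (\<lambda>_. 0) (\<lambda>_ y \<sigma>. [:l \<sigma>:] + [:t:] * (system y \<sigma> + [:0, 1:] * y \<sigma> ^ d))"
  have Y0: "Y 0 \<sigma> = 0" and Y_Suc: "Y (Suc h) \<sigma> = [:l \<sigma>:] + [:t:] * (system (Y h) \<sigma> + [:0, 1:] * Y h \<sigma> ^ d)"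
    for h \<sigma> by (simp_all add: Y_def)
  have YF: "\<sigma> \<in> S \<Longrightarrow> poly (Y h \<sigma>) 0 = F h \<sigma>" for h \<sigma>
  proof (induction h arbitrary: \<sigma>)
    case (Suc h)
    then show ?case
      by (simp add: Y_Suc F_Suc poly_system cong: system_cong)
  qed (simp add: Y0 F0)
  have pf: "polyfun S d (\<lambda>y. system y \<sigma> + [:0, 1:] * y \<sigma> ^ d)" if "\<sigma> \<in> S" for \<sigma>
    by (intro polyfun.add polyfun_scale polyfun_mono[OF polyfun_system]
          polyfun_power[of S 1 _ d, simplified] polyfun_var finite_S that) (auto simp: d_def)
  \<comment> \<open>The iteration is contracting: each round multiplies the difference of two
    iterates by a multiple of \<open>t\<close>.\<close>
  have step: "[:t:] ^ h dvd Y (Suc h) \<sigma> - Y h \<sigma>" if "\<sigma> \<in> S" for h \<sigma>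
    using that
  proof (induction h arbitrary: \<sigma>)
    case (Suc h)
    have "Y (Suc (Suc h)) \<sigma> - Y (Suc h) \<sigma>
      = [:t:] * ((system (Y (Suc h)) \<sigma> + [:0, 1:] * Y (Suc h) \<sigma> ^ d)
          - (system (Y h) \<sigma> + [:0, 1:] * Y h \<sigma> ^ d))"
      unfolding Y_Suc[of "Suc h"] Y_Suc[of h \<sigma>] right_diff_distrib by simp
    moreover have "[:t:] ^ h dvd (system (Y (Suc h)) \<sigma> + [:0, 1:] * Y (Suc h) \<sigma> ^ d)
          - (system (Y h) \<sigma> + [:0, 1:] * Y h \<sigma> ^ d)"
      by (rule polyfun_cong_dvd[OF pf[OF Suc.prems]]) (rule Suc.IH)
    ultimately show ?case by (simp only: power_Suc mult_dvd_mono dvd_refl)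
  qed simp
  \<comment> \<open>The fixed point equation solved for its top term, whose coefficient
    \<open>e\<close> is \<open>[:0, t:]\<close>, that is, \<open>t \<epsilon>\<close>.\<close>
  define \<Psi> where "\<Psi> = (\<lambda>\<sigma> y. y \<sigma> - [:l \<sigma>:] - [:t:] * system y \<sigma>)"
  have \<Psi>: "polyfun S (d - 1) (\<Psi> \<sigma>)" if "\<sigma> \<in> S" for \<sigma>
    unfolding \<Psi>_def
    by (intro polyfun_diff polyfun_scale polyfun_const polyfun_mono[OF polyfun_system]
          polyfun_var finite_S that) (auto simp: d_def)
  have p: "polyfun S 1 (\<lambda>y. \<Sum>\<sigma>\<in>S. y \<sigma> :: 'a poly)"
    by (intro polyfun_sum polyfun_var finite_S) auto
  have d0: "d > 0" by (simp add: d_def)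
  have e0: "[:0, t:] \<noteq> 0" using t by simp
  obtain Q where Q: "Q \<noteq> 0" "\<And>m y. \<forall>\<sigma>\<in>S. m dvd [:0, t:] * y \<sigma> ^ d - \<Psi> \<sigma> y
      \<Longrightarrow> m dvd poly Q (\<Sum>\<sigma>\<in>S. y \<sigma>)"
      proof (rule elimination[OF finite_S d0 e0 \<Psi> p])
    fix Q :: "'a poly poly" assume "Q \<noteq> 0" "\<And>m y. \<forall>\<sigma>\<in>S. m dvd [:0, t:] * y \<sigma> ^ d - \<Psi> \<sigma> y
      \<Longrightarrow> m dvd poly Q (\<Sum>\<sigma>\<in>S. y \<sigma>)"
    then show thesis by (rule that)
  qed
  have "[:t ^ h:] dvd poly Q (\<Sum>\<sigma>\<in>S. Y h \<sigma>)" for h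
  proof (rule Q(2), intro ballI)
    fix \<sigma> assume "\<sigma> \<in> S"
    \<comment> \<open>The defect of an iterate in the relation is its difference from the next
      iterate.\<close>
    have "[:0, t:] * Y h \<sigma> ^ d - \<Psi> \<sigma> (Y h) = Y (Suc h) \<sigma> - Y h \<sigma>"
      by (simp add: \<Psi>_def Y_Suc algebra_simps)
    then show "[:t ^ h:] dvd [:0, t:] * Y h \<sigma> ^ d - \<Psi> \<sigma> (Y h)"
      using step[OF \<open>\<sigma> \<in> S\<close>, of h] by (simp add: poly_const_pow)
  qed
  moreover obtain R where "R \<noteq> 0" "\<And>m y. [:m:] dvd poly Q y \<Longrightarrow> m dvd poly R (poly y 0)"
    using specialization[OF Q(1)] by blast
  ultimately show ?thesis using that[of R] by (fastforce simp: poly_sum YF)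
qed

text \<open>Removing the root splits a nontrivial accepted tree into a label and a list of accepted
  trees of smaller height. Grouping the lists by their words of states gives the transitions, and
  \<open>[:0, 1:]\<close> accounts for the removed vertex.\<close>

lemma accepted_weight_recursion:
  assumes "\<sigma> \<in> S"
  shows "(\<Sum>s | s \<in> accepted (Suc h) \<and> st s = \<sigma>. tree_weight s)
    = (if st Leaf = \<sigma> then [:monom 1 1:] else 0)
      + [:0, 1:] * system (\<lambda>\<tau>. \<Sum>s | s \<in> accepted h \<and> st s = \<tau>. tree_weight s) \<sigma>"
proof -
  let ?N = "accepted h"
  let ?L = "if st Leaf = \<sigma> then {Leaf :: 'g tree} else {}"
  let ?T = "\<lambda>\<sigma>s. {ts. set ts \<subseteq> ?N \<and> map st ts = \<sigma>s}"
  \<comment> \<open>Keeping the word of states as a component of its own lets the sum be split along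
    the transitions.\<close>
  let ?Z = "Sigma (Sigma U (\<lambda>a. transitions a \<sigma>)) (\<lambda>(a, \<sigma>s). ?T \<sigma>s)"
  have fT: "finite (?T \<sigma>s)" for \<sigma>s
    by (rule finite_subset[OF _ finite_lists_length_eq[OF finite_accepted[of h], of "length \<sigma>s"]]) auto
  have fX: "finite (Sigma U (\<lambda>a. transitions a \<sigma>))" using finite_U finite_transitions by auto
  then have fZ: "finite ?Z" by (rule finite_SigmaI) (auto simp: fT)
  have Z: "{s. s \<in> accepted (Suc h) \<and> st s = \<sigma>} = ?L \<union> (\<lambda>((a, \<sigma>s), ts). Node a ts) ` ?Z"
  proof (intro equalityI subsetI)
    fix s assume s: "s \<in> {s. s \<in> accepted (Suc h) \<and> st s = \<sigma>}"
    show "s \<in> ?L \<union> (\<lambda>((a, \<sigma>s), ts). Node a ts) ` ?Z"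
    proof (cases s)
      case (Node a ts)
      then have "a \<in> U" "length ts = ar a" "set ts \<subseteq> ?N" "\<delta> a (map st ts) = \<sigma>"
        using s by (auto simp: st_Node)
      then have "((a, map st ts), ts) \<in> ?Z" by (auto simp: transitions_def dest: accepted_state)
      then show ?thesis unfolding Node by (intro UnI2 image_eqI) auto
    qed (use s in auto)
  next
    fix s assume "s \<in> ?L \<union> (\<lambda>((a, \<sigma>s), ts). Node a ts) ` ?Z"
    then show "s \<in> {s. s \<in> accepted (Suc h) \<and> st s = \<sigma>}"
      using assms by (auto simp: transitions_def st_Node split: if_splits)
  qed
  have inj: "inj_on (\<lambda>((a, \<sigma>s), ts). Node a ts) ?Z" by (auto simp: inj_on_def)
  have "(\<Sum>s | s \<in> accepted (Suc h) \<and> st s = \<sigma>. tree_weight s)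
    = sum tree_weight ?L + sum tree_weight ((\<lambda>((a, \<sigma>s), ts). Node a ts) ` ?Z)"
    unfolding Z using fZ by (intro sum.union_disjoint) auto
  also have "sum tree_weight ?L = (if st Leaf = \<sigma> then [:monom 1 1:] else 0)" by simp
  also have "sum tree_weight ((\<lambda>((a, \<sigma>s), ts). Node a ts) ` ?Z)
      = (\<Sum>((a, \<sigma>s), ts)\<in>?Z. [:0, 1:] * prod_list (map tree_weight ts))"
    unfolding sum.reindex[OF inj] by (intro sum.cong) auto
  also have "\<dots> = (\<Sum>(a, \<sigma>s)\<in>Sigma U (\<lambda>a. transitions a \<sigma>). \<Sum>ts\<in>?T \<sigma>s. [:0, 1:] * prod_list (map tree_weight ts))"
    using sum.Sigma[OF fX, of "\<lambda>(a, \<sigma>s). ?T \<sigma>s" "\<lambda>_ ts. [:0, 1:] * prod_list (map tree_weight ts)"] fT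
    by (simp add: split_def)
  also have "\<dots> = (\<Sum>a\<in>U. \<Sum>\<sigma>s\<in>transitions a \<sigma>. \<Sum>ts\<in>?T \<sigma>s. [:0, 1:] * prod_list (map tree_weight ts))"
    using finite_U finite_transitions by (intro sum.Sigma[symmetric]) auto
  also have "\<dots> = [:0, 1:] * system (\<lambda>\<tau>. \<Sum>s | s \<in> ?N \<and> st s = \<tau>. tree_weight s) \<sigma>"
    unfolding system_def sum_distrib_left
    by (intro sum.cong refl)
       (simp only: sum_distrib_left[symmetric] sum_prod_list_map[OF finite_accepted])
  finally show ?thesis .
qed

text \<open>By finiteness, the trees with few leaves all appear by some height. This converts
  congruences modulo powers of the vertex variable into congruences modulo powers of the leaf
  variable, after which the vertex variable can be set to \<open>1\<close>.\<close>

theorem accepted_series_algebraic: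
  assumes fin: "\<And>n. finite {s \<in> (\<Union>h. accepted h). leaves s = n}"
  shows "algebraic_series (Abs_fps (\<lambda>n. of_nat (card {s \<in> (\<Union>h. accepted h). leaves s = n})))"
    (is "algebraic_series ?f")
proof -
  define G where "G h = (\<Sum>s\<in>accepted h. tree_weight s)" for h
  define F where "F h \<sigma> = (\<Sum>s | s \<in> accepted h \<and> st s = \<sigma>. tree_weight s)" for h \<sigma>
  have GF: "G h = (\<Sum>\<sigma>\<in>S. F h \<sigma>)" for h
    unfolding G_def F_def
    by (rule sum.group[symmetric]) (auto simp: finite_accepted finite_S dest: accepted_state)
  obtain Q where Q: "Q \<noteq> 0" "\<And>h. [:0, 1:] ^ h dvd poly Q (G h)"
  proof (rule system_iterates_annihilated[of "[:0, 1:]" F "\<lambda>\<sigma>. if st Leaf = \<sigma> then [:monom 1 1:] else 0"])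
    show "F (Suc h) \<sigma> = (if st Leaf = \<sigma> then [:monom 1 1:] else 0) + [:0, 1:] * system (F h) \<sigma>"
      if "\<sigma> \<in> S" for h \<sigma>
      using accepted_weight_recursion[OF that, of h] unfolding F_def .
  qed (auto simp: F_def GF)
  obtain R where R: "R \<noteq> 0" "\<And>m y. [:m:] dvd poly Q y \<Longrightarrow> m dvd poly R (poly y 1)"
    using specialization[OF Q(1)] by blast
  have "fps_nth (poly (map_poly fps_of_poly R) ?f) k = 0" for k
  proof -
    \<comment> \<open>The coefficient at \<open>k\<close> is visible modulo the power
      \<open>k + 1\<close> of the variable.\<close>
    define n where "n = Suc k"
    have "finite (\<Union>j<n. {s \<in> (\<Union>h. accepted h). leaves s = j})" using fin by auto
    then obtain H where "(\<Union>j<n. {s \<in> (\<Union>h. accepted h). leaves s = j}) \<subseteq> accepted H"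
      using finite_subset_accepted by blast
    then have H: "\<And>s h. s \<in> accepted h \<Longrightarrow> leaves s < n \<Longrightarrow> s \<in> accepted H"
      by blast
    have stable: "[:monom 1 n:] dvd G h - G H" if "h \<ge> H" for h
    proof -
      have "G h - G H = (\<Sum>s\<in>accepted h - accepted H. tree_weight s)"
        using sum.subset_diff[OF accepted_mono[OF that] finite_accepted, of tree_weight]
        by (simp add: G_def)
      also have "[:monom 1 n:] dvd \<dots>"
      proof (intro dvd_sum monom_dvd_tree_weight)
        show "n \<le> leaves s" if "s \<in> accepted h - accepted H" for s
          using H[of s h] that by (meson DiffD1 DiffD2 not_less)
      qed
      finally show ?thesis .
    qed
    have "[:monom 1 n:] dvd poly Q (G H)"
      unfolding const_poly_dvd_iff
    proof
      fix j
      \<comment> \<open>Being at least \<open>H\<close>, this height makes \<open>G\<close> stable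
        modulo \<open>monom 1 n\<close>; exceeding \<open>j\<close>, it makes the coefficient of
        \<open>poly Q (G ?h)\<close> at \<open>j\<close> vanish.\<close>
      let ?h = "max H (Suc j)"
      have "monom 1 ?h dvd poly Q (G ?h)" using Q(2)[of ?h] by (simp add: monom_altdef)
      then have "coeff (poly Q (G ?h)) j = 0" unfolding monom_1_dvd_iff' by auto
      moreover have "[:monom 1 n:] dvd poly Q (G ?h) - poly Q (G H)"
        by (intro poly_dvd_diff stable) simp
      then have "monom 1 n dvd coeff (poly Q (G ?h)) j - coeff (poly Q (G H)) j"
        unfolding const_poly_dvd_iff by simp
      ultimately show "monom 1 n dvd coeff (poly Q (G H)) j" by simp
    qed
    \<comment> \<open>Only now is the vertex variable set to \<open>1\<close>: a congruence modulo
      its powers would become empty.\<close>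
    then have "monom 1 n dvd poly R (poly (G H) 1)" by (rule R)
    then have R0: "coeff (poly R (poly (G H) 1)) k = 0" by (simp add: monom_1_dvd_iff' n_def)
    have "fps_X ^ n dvd ?f - fps_of_poly (poly (G H) 1)"
      unfolding fps_X_power_dvd_iff
    proof (intro allI impI)
      fix j assume "j < n"
      have "coeff (poly (G H) 1) j = (\<Sum>s\<in>accepted H. if leaves s = j then 1 else 0)"
        by (simp add: G_def poly_sum poly_tree_weight coeff_sum)
      also have "\<dots> = of_nat (card {s \<in> accepted H. leaves s = j})"
        using finite_accepted by (simp add: sum.If_cases Int_def)
      also have "{s \<in> accepted H. leaves s = j} = {s \<in> (\<Union>h. accepted h). leaves s = j}"
        using H \<open>j < n\<close> by auto
      finally show "fps_nth (?f - fps_of_poly (poly (G H) 1)) j = 0" by simp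
    qed
    then have "fps_X ^ n dvd poly (map_poly fps_of_poly R) ?f
        - poly (map_poly fps_of_poly R) (fps_of_poly (poly (G H) 1))"
      by (rule poly_dvd_diff)
    moreover have "poly (map_poly fps_of_poly R) (fps_of_poly p) = fps_of_poly (poly R p)" for p
      by (induction R) (auto simp: map_poly_pCons fps_of_poly_add fps_of_poly_mult)
    ultimately have "fps_X ^ n dvd poly (map_poly fps_of_poly R) ?f - fps_of_poly (poly R (poly (G H) 1))"
      by simp
    then have "fps_nth (poly (map_poly fps_of_poly R) ?f - fps_of_poly (poly R (poly (G H) 1))) k = 0"
      unfolding fps_X_power_dvd_iff n_def by blast
    then show ?thesis using R0 by simp
  qed
  then have "poly (map_poly fps_of_poly R) ?f = 0" by (simp add: fps_eq_iff)
  then show ?thesis using R(1) unfolding algebraic_series_def by blast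
qed

end

section \<open>Pattern avoidance\<close>

fun subtrees :: "'g tree \<Rightarrow> 'g tree set" where
  "subtrees Leaf = {Leaf}"
| "subtrees (Node a ts) = insert (Node a ts) (\<Union>t\<in>set ts. subtrees t)"

lemma finite_subtrees: "finite (subtrees t)"
  by (induction t) auto

lemma subtrees_refl: "t \<in> subtrees t"
  by (cases t) auto

text \<open>Closure under children makes the state of a tree computable from the states of its
  children.\<close>

lemma subtrees_child: "Node a ws \<in> subtrees t \<Longrightarrow> w \<in> set ws \<Longrightarrow> w \<in> subtrees t"
  by (induction t) (auto intro: subtrees_refl)

lemma occurs_at_root_Node:
  "occurs_at_root w (Node a vs) \<longleftrightarrow>
     w = Leaf \<or> (\<exists>ws. w = Node a ws \<and> list_all2 occurs_at_root ws vs)"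
  by (subst occurs_at_root.simps) auto

lemma tree_divides_Node:
  "tree_divides w (Node a vs) \<longleftrightarrow>
     occurs_at_root w (Node a vs) \<or> (\<exists>v\<in>set vs. tree_divides w v)"
  by (subst tree_divides.simps) auto

lemma tree_divides_Leaf: "tree_divides w Leaf \<longleftrightarrow> occurs_at_root w Leaf"
  by (subst tree_divides.simps) auto

text \<open>The state of a tree is the set of all subtrees of the patterns that occur at its root.\<close>

theorem avoiding_series_algebraic:
  fixes U :: "'g set" and W :: "'g tree set"
  assumes "finite U" and "finite W"
    and fin: "\<And>n. finite {s \<in> trees U ar. leaves s = n \<and> (\<forall>w\<in>W. \<not> tree_divides w s)}"
  shows "algebraic_series
    (Abs_fps (\<lambda>n. of_nat (card {s \<in> trees U ar. leaves s = n \<and> (\<forall>w\<in>W. \<not> tree_divides w s)})))"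
proof -
  define X where "X = (\<Union>w\<in>W. subtrees w)"
  define st where "st = (\<lambda>s. {w \<in> X. occurs_at_root w s})"
  define \<delta> where "\<delta> = (\<lambda>a \<sigma>s. {w \<in> X. w = Leaf \<or> (\<exists>ws. w = Node a ws \<and> list_all2 (\<in>) ws \<sigma>s)})"
  \<comment> \<open>Divisibility is occurrence at the root of some subtree, so a tree avoids
    \<open>W\<close> exactly if no state along it contains a pattern from \<open>W\<close>.\<close>
  define S where "S = {\<sigma> \<in> Pow X. \<sigma> \<inter> W = {}}"
  have X: "finite X" "W \<subseteq> X"
    using \<open>finite W\<close> by (auto simp: X_def finite_subtrees intro: subtrees_refl)
  have X_child: "w \<in> X" if "Node a ws \<in> X" "w \<in> set ws" for a ws w
  proof -
    obtain p where "p \<in> W" "Node a ws \<in> subtrees p" using \<open>Node a ws \<in> X\<close> by (auto simp: X_def)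
    then show ?thesis using subtrees_child[of a ws p w] \<open>w \<in> set ws\<close> by (auto simp: X_def)
  qed
  interpret tree_automaton U ar st \<delta> S
  proof
    fix a and ts :: "'g tree list"
    have "list_all2 occurs_at_root ws ts \<longleftrightarrow> list_all2 (\<in>) ws (map st ts)" if "Node a ws \<in> X" for ws
      using X_child[OF that] by (auto simp: list_all2_conv_all_nth st_def)
    then show "st (Node a ts) = \<delta> a (map st ts)"
      by (auto simp: st_def \<delta>_def occurs_at_root_Node)
  qed (use \<open>finite U\<close> X(1) in \<open>auto simp: S_def\<close>)
  have S: "st s \<in> S \<longleftrightarrow> (\<forall>w\<in>W. \<not> occurs_at_root w s)" for s
    using X(2) by (auto simp: st_def S_def)
  have "s \<in> trees U ar \<and> (\<forall>w\<in>W. \<not> tree_divides w s)" if "s \<in> accepted h" for s h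
    using that
  proof (induction h arbitrary: s)
    case (Suc h)
    then show ?case
      by (auto simp: S tree_divides_Node tree_divides_Leaf subset_iff intro: trees.intros)
  qed simp
  moreover have "s \<in> (\<Union>h. accepted h)" if "s \<in> trees U ar" "\<forall>w\<in>W. \<not> tree_divides w s" for s
    using that
  proof (induction rule: trees.induct)
    case Leaf
    then have "Leaf \<in> accepted 1" by (simp add: S tree_divides_Leaf)
    then show ?case by blast
  next
    case (Node a ts)
    then have "set ts \<subseteq> (\<Union>h. accepted h)" by (auto simp: tree_divides_Node)
    then obtain H where "set ts \<subseteq> accepted H" using finite_subset_accepted by blast
    then have "Node a ts \<in> accepted (Suc H)" using Node by (auto simp: S tree_divides_Node)
    then show ?case by blast
  qed
  ultimately have "(\<Union>h. accepted h) = {s \<in> trees U ar. \<forall>w\<in>W. \<not> tree_divides w s}" by blast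
  then have "{s \<in> (\<Union>h. accepted h). leaves s = n}
      = {s \<in> trees U ar. leaves s = n \<and> (\<forall>w\<in>W. \<not> tree_divides w s)}" for n
    by blast
  then show ?thesis using accepted_series_algebraic fin by simp
qed

section \<open>Leading and normal monomials\<close>

definition graft_step :: "'g set \<Rightarrow> ('g \<Rightarrow> nat) \<Rightarrow> 'g tree \<Rightarrow> 'g tree \<Rightarrow> bool" where
  "graft_step U ar x y \<longleftrightarrow> (\<exists>i t. 1 \<le> i \<and> i \<le> leaves x \<and> t \<in> trees U ar \<and> y = graft x i t)"

lemma graft_list_append:
  "1 \<le> i \<Longrightarrow> i \<le> leaves x \<Longrightarrow>
    graft_list (us @ x # zs) (sum_list (map leaves us) + i) t = us @ graft x i t # zs"
  by (induction us) (auto simp: add.assoc)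

lemma graft_step_Node:
  assumes "graft_step U ar x y"
  shows "graft_step U ar (Node a (us @ x # zs)) (Node a (us @ y # zs))"
proof -
  obtain i t where i: "1 \<le> i" "i \<le> leaves x" "t \<in> trees U ar" "y = graft x i t"
    using assms by (auto simp: graft_step_def)
  then show ?thesis unfolding graft_step_def
    using graft_list_append[of i x us zs t]
    by (intro exI[of _ "sum_list (map leaves us) + i"] exI[of _ t]) auto
qed

lemma graft_steps_Node:
  "(graft_step U ar)\<^sup>*\<^sup>* x y \<Longrightarrow>
    (graft_step U ar)\<^sup>*\<^sup>* (Node a (us @ x # zs)) (Node a (us @ y # zs))"
  by (induction rule: rtranclp_induct) (auto intro: graft_step_Node rtranclp.rtrancl_into_rtrancl)

lemma Node_in_trees: "Node a ts \<in> trees U ar \<longleftrightarrow> a \<in> U \<and> length ts = ar a \<and> set ts \<subseteq> trees U ar"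
  by (subst trees.simps) auto

text \<open>The parts of \<open>v\<close> missing in \<open>w\<close> are grafted onto the leaves of
  \<open>w\<close> one after another. Closure under grafting therefore implies closure under
  extending an occurrence at the root.\<close>

lemma occurs_at_root_graft_steps:
  "occurs_at_root w v \<Longrightarrow> v \<in> trees U ar \<Longrightarrow> (graft_step U ar)\<^sup>*\<^sup>* w v"
proof (induction rule: occurs_at_root.induct)
  case (Leaf v)
  then have "graft_step U ar Leaf v" by (auto simp: graft_step_def)
  then show ?case by blast
next
  case (Node ws vs a)
  have "set vs \<subseteq> trees U ar" using Node.prems by (simp add: Node_in_trees)
  \<comment> \<open>The prefix \<open>us\<close> holds the children already completed; the others
    are treated from left to right.\<close>
  with Node.IH have "(graft_step U ar)\<^sup>*\<^sup>* (Node a (us @ ws)) (Node a (us @ vs))" for us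
  proof (induction arbitrary: us rule: list_all2_induct)
    case (Cons w ws v vs)
    have "(graft_step U ar)\<^sup>*\<^sup>* (Node a (us @ w # ws)) (Node a (us @ v # ws))"
      using Cons by (intro graft_steps_Node) auto
    also have "(graft_step U ar)\<^sup>*\<^sup>* (Node a (us @ v # ws)) (Node a (us @ v # vs))"
      using Cons.IH[of "us @ [v]"] Cons.prems by simp
    finally show ?case .
  qed simp
  from this[of "[]"] show ?case by simp
qed

section \<open>Leading monomials of an ideal\<close>

lemma linear_order_finite_max:
  assumes r: "linear_order_on A r" and "finite K" "K \<noteq> {}" "K \<subseteq> A"
  shows "\<exists>t\<in>K. \<forall>s\<in>K. (s, t) \<in> r"
  using assms(2-4)
proof (induction K rule: finite_ne_induct)
  case (singleton x)
  then show ?case using r by (auto simp: order_on_defs refl_on_def)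
next
  case (insert x K)
  then obtain t where t: "t \<in> K" "\<forall>s\<in>K. (s, t) \<in> r" by auto
  then have "t \<in> A" "x \<in> A" using insert.prems by auto
  have r': "refl_on A r" "total_on A r" "trans r" using r by (simp_all add: order_on_defs)
  show ?case
  proof (cases "(x, t) \<in> r")
    case True
    then show ?thesis using t by auto
  next
    case False
    have xx: "(x, x) \<in> r" using r'(1) \<open>x \<in> A\<close> by (rule refl_onD)
    then have "(t, x) \<in> r"
      using r'(2) False \<open>t \<in> A\<close> \<open>x \<in> A\<close> by (auto simp: total_on_def)
    then have "(s, x) \<in> r" if "s \<in> K" for s using t(2) that r'(3) by (auto dest: transD)
    then show ?thesis using xx by auto
  qed
qed

text \<open>Every vertex has an input, so each branch ends in a leaf. This keeps all arities in the
  positive range, where the order and the ideal are governed by the axioms.\<close>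

lemma leaves_ge_1:
  assumes "\<And>a. a \<in> U \<Longrightarrow> ar a \<ge> 1"
  shows "t \<in> trees U ar \<Longrightarrow> leaves t \<ge> 1"
proof (induction rule: trees.induct)
  case (Node a ts)
  then have "ts \<noteq> []" using assms by fastforce
  then show ?case using Node.IH by (cases ts) (auto intro: trans_le_add1)
qed simp

locale free_operad_ideal =
  fixes U :: "'g set" and ar :: "'g \<Rightarrow> nat"
    and C :: "nat \<Rightarrow> ('g tree \<Rightarrow>\<^sub>0 'k::field) set"
    and ord :: "nat \<Rightarrow> ('g tree \<times> 'g tree) set"
  assumes ar: "\<And>a. a \<in> U \<Longrightarrow> ar a \<ge> 1"
    and ideal: "operad_ideal C (free_operad U ar)"
    and admissible: "admissible_order U ar ord"
begin

lemma well_order: "n \<ge> 1 \<Longrightarrow> well_order_on (tree_monomials U ar n) (ord n)"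
  using admissible by (simp add: admissible_order_def)

lemma linear_order: "n \<ge> 1 \<Longrightarrow> linear_order_on (tree_monomials U ar n) (ord n)"
  using well_order by (simp add: well_order_on_def)

lemma ord_refl: "n \<ge> 1 \<Longrightarrow> t \<in> tree_monomials U ar n \<Longrightarrow> (t, t) \<in> ord n"
  using linear_order[of n] by (auto simp: order_on_defs refl_on_def)

lemma ideal_keys: "n \<ge> 1 \<Longrightarrow> f \<in> C n \<Longrightarrow> Poly_Mapping.keys f \<subseteq> tree_monomials U ar n"
  using ideal by (auto simp: operad_ideal_def free_operad_def)

text \<open>Maximality is stated directly, which avoids the description operator in
  \<open>leading_monomial\<close>; zero has no keys and contributes nothing.\<close>

definition leading :: "nat \<Rightarrow> 'g tree set" where
  "leading n = {t. \<exists>f\<in>C n. t \<in> Poly_Mapping.keys f \<and> (\<forall>s\<in>Poly_Mapping.keys f. (s, t) \<in> ord n)}"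

lemma leading_monomial:
  assumes "n \<ge> 1" "f \<in> C n" "f \<noteq> 0"
  shows "leading_monomial ord n f \<in> Poly_Mapping.keys f"
    and "\<And>s. s \<in> Poly_Mapping.keys f \<Longrightarrow> (s, leading_monomial ord n f) \<in> ord n"
proof -
  let ?P = "\<lambda>t. t \<in> Poly_Mapping.keys f \<and> (\<forall>s\<in>Poly_Mapping.keys f. (s, t) \<in> ord n)"
  have "\<exists>t. ?P t"
    using linear_order_finite_max[OF linear_order[OF assms(1)] finite_keys _ ideal_keys[OF assms(1,2)]]
      assms(3) by auto
  moreover have "antisym (ord n)" using linear_order[OF assms(1)] by (simp add: order_on_defs)
  ultimately have "\<exists>!t. ?P t" by (meson antisymD)
  from theI'[OF this] have "?P (leading_monomial ord n f)" unfolding leading_monomial_def .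
  then show "leading_monomial ord n f \<in> Poly_Mapping.keys f"
    and "\<And>s. s \<in> Poly_Mapping.keys f \<Longrightarrow> (s, leading_monomial ord n f) \<in> ord n" by auto
qed

lemma leading_subset: "n \<ge> 1 \<Longrightarrow> leading n \<subseteq> tree_monomials U ar n"
  using ideal_keys by (auto simp: leading_def)

lemma graft_monomial:
  assumes "1 \<le> i" "i \<le> n" "s \<in> tree_monomials U ar n" "t \<in> tree_monomials U ar m"
  shows "graft s i t \<in> tree_monomials U ar (n + m - 1)"
  using assms leaves_graft(1)[of i s t] trees_graft(1)[of s U ar t i]
  by (auto simp: tree_monomials_def)

lemma single_in_component: "t \<in> tree_monomials U ar n \<Longrightarrow> Poly_Mapping.single t 1 \<in> component (free_operad U ar) n"
  by (simp add: free_operad_def)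

text \<open>Strict monotonicity of \<open>h\<close> prevents the image of the leading term from cancelling.\<close>

lemma leading_image:
  assumes n': "n' \<ge> 1"
    and t: "t \<in> Poly_Mapping.keys f" "\<And>s. s \<in> Poly_Mapping.keys f \<Longrightarrow> (s, t) \<in> ord n"
    and g: "g = (\<Sum>s\<in>Poly_Mapping.keys f. Poly_Mapping.single (h s) (Poly_Mapping.lookup f s))" "g \<in> C n'"
    and h: "h t \<in> tree_monomials U ar n'"
      "\<And>s. (s, t) \<in> ord n - Id \<Longrightarrow> (h s, h t) \<in> ord n' - Id"
  shows "h t \<in> leading n'"
proof -
  have "Poly_Mapping.lookup g (h t)
      = (\<Sum>s\<in>Poly_Mapping.keys f. if s = t then Poly_Mapping.lookup f s else 0)"
    unfolding g(1) lookup_sum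
  proof (intro sum.cong refl)
    fix s assume "s \<in> Poly_Mapping.keys f"
    then have "s = t \<or> h s \<noteq> h t" using t(2) h(2) by auto
    then show "Poly_Mapping.lookup (Poly_Mapping.single (h s) (Poly_Mapping.lookup f s)) (h t)
        = (if s = t then Poly_Mapping.lookup f s else 0)"
      by (auto simp: lookup_single when_def)
  qed
  then have "h t \<in> Poly_Mapping.keys g" using t(1) by (simp add: in_keys_iff)
  moreover have "(u, h t) \<in> ord n'" if u: "u \<in> Poly_Mapping.keys g" for u
  proof -
    obtain s where "s \<in> Poly_Mapping.keys f" "u = h s"
      using u Poly_Mapping.keys_sum[of "\<lambda>s. Poly_Mapping.single (h s) (Poly_Mapping.lookup f s)" "Poly_Mapping.keys f"]
      unfolding g(1) by (auto split: if_splits)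
    then show ?thesis using t(2)[of s] h ord_refl[OF n'] by (cases "s = t") auto
  qed
  ultimately show ?thesis using g(2) by (auto simp: leading_def)
qed

text \<open>Composition with the monomial \<open>t\<close> keeps an element in the ideal and acts on
  its monomials by a strictly increasing map, so the leading monomial is carried to the leading
  monomial.\<close>

lemma leading_graft_left:
  assumes i: "1 \<le> i" "i \<le> n" "m \<ge> 1" and w: "w \<in> leading n" and t: "t \<in> tree_monomials U ar m"
  shows "graft w i t \<in> leading (n + m - 1)"
proof -
  obtain f where f: "f \<in> C n" "w \<in> Poly_Mapping.keys f" "\<And>s. s \<in> Poly_Mapping.keys f \<Longrightarrow> (s, w) \<in> ord n"
    using w by (auto simp: leading_def)
  show ?thesis
  proof (rule leading_image[OF _ f(2,3), where h = "\<lambda>s. graft s i t"])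
    show "free_pcomp i f (Poly_Mapping.single t 1) \<in> C (n + m - 1)"
      using ideal single_in_component[OF t] i f(1)
      unfolding operad_ideal_def by (simp add: free_operad_def)
    show "graft w i t \<in> tree_monomials U ar (n + m - 1)"
      using w leading_subset[of n] i t by (intro graft_monomial) auto
    show "(graft s i t, graft w i t) \<in> ord (n + m - 1) - Id" if "(s, w) \<in> ord n - Id" for s
      using admissible that i t unfolding admissible_order_def by blast
  qed (use i in \<open>auto simp: free_pcomp_def\<close>)
qed

lemma leading_graft_right:
  assumes i: "1 \<le> i" "i \<le> n" "m \<ge> 1" and s: "s \<in> tree_monomials U ar n" and w: "w \<in> leading m"
  shows "graft s i w \<in> leading (n + m - 1)"
proof -
  obtain f where f: "f \<in> C m" "w \<in> Poly_Mapping.keys f" "\<And>s. s \<in> Poly_Mapping.keys f \<Longrightarrow> (s, w) \<in> ord m"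
    using w by (auto simp: leading_def)
  show ?thesis
  proof (rule leading_image[OF _ f(2,3), where h = "\<lambda>t. graft s i t"])
    show "free_pcomp i (Poly_Mapping.single s 1) f \<in> C (n + m - 1)"
      using ideal single_in_component[OF s] i f(1)
      unfolding operad_ideal_def by (simp add: free_operad_def)
    show "graft s i w \<in> tree_monomials U ar (n + m - 1)"
      using w leading_subset[of m] i s by (intro graft_monomial) auto
    show "(graft s i t, graft s i w) \<in> ord (n + m - 1) - Id" if "(t, w) \<in> ord m - Id" for t
      using admissible that i s unfolding admissible_order_def by blast
  qed (use i in \<open>auto simp: free_pcomp_def\<close>)
qed

lemma leading_graft_step:
  assumes "graft_step U ar x y" "x \<in> leading (leaves x)"
  shows "y \<in> leading (leaves y)"
proof -
  obtain i t where i: "1 \<le> i" "i \<le> leaves x" "t \<in> trees U ar" "y = graft x i t"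
    using assms(1) by (auto simp: graft_step_def)
  have t: "leaves t \<ge> 1" using i(3) leaves_ge_1[of U ar] ar by blast
  then have "leaves x + leaves t - 1 = leaves y"
    using leaves_graft(1)[OF i(1,2), of t] i(4) by simp
  moreover have "graft x i t \<in> leading (leaves x + leaves t - 1)"
    using i t assms(2) by (intro leading_graft_left) (auto simp: tree_monomials_def)
  ultimately show ?thesis using i(4) by simp
qed

text \<open>An occurrence at the root is extended by grafting at its leaves. A deeper one lies in a
  child that is leading by induction, and this child is grafted into the rest of the tree.\<close>

lemma leading_divides:
  assumes "tree_divides w v" "v \<in> trees U ar" "w \<in> leading (leaves w)"
  shows "v \<in> leading (leaves v)"
  using assms
proof (induction rule: tree_divides.induct)
  case (root w v)
  then have "(graft_step U ar)\<^sup>*\<^sup>* w v" by (intro occurs_at_root_graft_steps)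
  then show ?case using root(3) by (induction rule: rtranclp_induct) (auto intro: leading_graft_step)
next
  case (child v vs w a)
  obtain us zs where vs: "vs = us @ v # zs" using split_list[OF child(1)] by blast
  \<comment> \<open>The tree with the child \<open>v\<close> cut off, and the number of the leaf
    left in its place.\<close>
  let ?s = "Node a (us @ Leaf # zs)" and ?i = "sum_list (map leaves us) + 1"
  have v: "v \<in> trees U ar" "?s \<in> trees U ar"
    using child.prems by (auto simp: vs Node_in_trees intro: trees.Leaf)
  have "graft ?s ?i v \<in> leading (leaves ?s + leaves v - 1)"
    using child v leaves_ge_1[OF ar v(1)]
    by (intro leading_graft_right) (auto simp: tree_monomials_def)
  moreover have "graft ?s ?i v = Node a vs" using graft_list_append[of 1 Leaf us zs v] by (simp add: vs)
  ultimately show ?case by (simp add: vs add_ac)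
qed

abbreviation normal_monomials :: "'g tree set \<Rightarrow> nat \<Rightarrow> 'g tree set" where
  "normal_monomials W n \<equiv> {s \<in> tree_monomials U ar n. \<forall>w\<in>W. \<not> tree_divides w s}"

text \<open>The \<open>n\<close>-ary component of the quotient, given by a linear map \<open>q\<close> on \<open>F(n)\<close> with kernel \<open>C(n)\<close>.\<close>

lemma normal_monomials_basis:
  fixes sc :: "'k \<Rightarrow> 'p::ab_group_add \<Rightarrow> 'p" and q :: "('g tree \<Rightarrow>\<^sub>0 'k) \<Rightarrow> 'p"
  assumes vs: "vector_space sc" and n: "n \<ge> 1"
    and groebner: "groebner_basis ord C G"
    and W: "W = {leading_monomial ord m g | m g. (m, g) \<in> G \<and> g \<noteq> 0}"
    and add: "\<And>x y. Poly_Mapping.keys x \<subseteq> tree_monomials U ar n \<Longrightarrow>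
        Poly_Mapping.keys y \<subseteq> tree_monomials U ar n \<Longrightarrow> q (x + y) = q x + q y"
    and scale: "\<And>c x. Poly_Mapping.keys x \<subseteq> tree_monomials U ar n \<Longrightarrow>
        q (Poly_Mapping.map ((*) c) x) = sc c (q x)"
    and kernel: "\<And>x. Poly_Mapping.keys x \<subseteq> tree_monomials U ar n \<Longrightarrow> q x = 0 \<longleftrightarrow> x \<in> C n"
    and image: "q ` {x. Poly_Mapping.keys x \<subseteq> tree_monomials U ar n} = V"
    and fin: "finite B" "module.span sc B = V"
  shows "finite (normal_monomials W n)"
    and "card (normal_monomials W n) = vector_space.dim sc V"
proof -
  interpret vector_space sc by fact
  let ?T = "tree_monomials U ar n" and ?N = "normal_monomials W n"
  let ?v = "\<lambda>t. q (Poly_Mapping.single t 1)"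
  have lookup: "Poly_Mapping.lookup (\<Sum>t\<in>X. Poly_Mapping.single t (c t)) s = (if s \<in> X then c s else 0)"
    if "finite X" for X and c :: "'g tree \<Rightarrow> 'k" and s
    using that by (simp add: lookup_sum lookup_single when_def)
  have keys: "Poly_Mapping.keys (\<Sum>t\<in>X. Poly_Mapping.single t (c t)) \<subseteq> X"
    if "finite X" for X and c :: "'g tree \<Rightarrow> 'k"
    using lookup[OF that] by (auto simp: in_keys_iff split: if_splits)
  have q_sum: "q (\<Sum>t\<in>X. Poly_Mapping.single t (c t)) = (\<Sum>t\<in>X. sc (c t) (?v t))"
    if "finite X" "X \<subseteq> ?T" for X and c :: "'g tree \<Rightarrow> 'k"
    using that
  proof (induction X rule: finite_induct)
    case empty
    show ?case using add[of 0 0] by simp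
  next
    case (insert t X)
    have "q (Poly_Mapping.single t (c t)) = sc (c t) (?v t)"
      using scale[of "Poly_Mapping.single t 1" "c t"] insert.prems by (simp add: map_times_single)
    moreover have "q (Poly_Mapping.single t (c t) + (\<Sum>t\<in>X. Poly_Mapping.single t (c t)))
        = q (Poly_Mapping.single t (c t)) + q (\<Sum>t\<in>X. Poly_Mapping.single t (c t))"
      using keys[OF insert.hyps(1), of c] insert.prems by (intro add) auto
    ultimately show ?case using insert by simp
  qed
  have expand: "p = (\<Sum>t\<in>Poly_Mapping.keys p. Poly_Mapping.single t (Poly_Mapping.lookup p t))"
    for p :: "'g tree \<Rightarrow>\<^sub>0 'k"
    by (rule poly_mapping_eqI) (simp add: lookup in_keys_iff)
  have q_expand: "q p = (\<Sum>t\<in>Poly_Mapping.keys p. sc (Poly_Mapping.lookup p t) (?v t))"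
    if "Poly_Mapping.keys p \<subseteq> ?T" for p
    using q_sum[of "Poly_Mapping.keys p" "Poly_Mapping.lookup p"] that expand[of p] by simp
  have W_leading: "w \<in> leading (leaves w)" if "w \<in> W" for w
  proof -
    obtain m g where g: "(m, g) \<in> G" "g \<noteq> 0" "w = leading_monomial ord m g" using \<open>w \<in> W\<close> W by blast
    then have m: "m \<ge> 1" "g \<in> C m" using groebner by (auto simp: groebner_basis_def)
    then have "w \<in> leading m" using leading_monomial[OF m g(2)] g(3) by (auto simp: leading_def)
    then show ?thesis using leading_subset[OF m(1)] by (auto simp: tree_monomials_def)
  qed
  have wf: "wf (ord n - Id)" using well_order[OF n] by (simp add: well_order_on_def)
  \<comment> \<open>A monomial that is not normal is the leading monomial of an element of
    \<open>C n\<close>; as \<open>q\<close> vanishes there, its image is a combination of images of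
    smaller monomials.\<close>
  have v_span: "?v t \<in> span (?v ` ?N)" if "t \<in> ?T" for t
    using wf that
  proof (induction t rule: wf_induct_rule)
    case (less t)
    show ?case
    proof (cases "t \<in> ?N")
      case True
      then show ?thesis by (intro span_base) auto
    next
      case False
      then obtain w where "w \<in> W" "tree_divides w t" using less.prems by blast
      then have "t \<in> leading n"
        using leading_divides[of w t] W_leading less.prems by (auto simp: tree_monomials_def)
      then obtain f where f: "f \<in> C n" "t \<in> Poly_Mapping.keys f"
        "\<And>s. s \<in> Poly_Mapping.keys f \<Longrightarrow> (s, t) \<in> ord n"
        by (auto simp: leading_def)
      let ?c = "Poly_Mapping.lookup f" and ?K = "Poly_Mapping.keys f - {t}"
      have fT: "Poly_Mapping.keys f \<subseteq> ?T" using ideal_keys n f(1) by blast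
      have "0 = q f" using kernel[OF fT] f(1) by simp
      also have "\<dots> = sc (?c t) (?v t) + (\<Sum>s\<in>?K. sc (?c s) (?v s))"
        unfolding q_expand[OF fT] by (rule sum.remove) (use f(2) in auto)
      finally have "sc (?c t) (?v t) = - (\<Sum>s\<in>?K. sc (?c s) (?v s))"
        by (simp add: eq_neg_iff_add_eq_0)
      then have "sc (inverse (?c t)) (sc (?c t) (?v t)) \<in> span (?v ` ?N)"
        using f(3) fT by (auto intro!: span_scale span_neg span_sum less.IH)
      then show ?thesis using f(2) by (simp add: in_keys_iff)
    qed
  qed
  \<comment> \<open>A nontrivial relation would give a nonzero element of \<open>C n\<close>
    supported on normal monomials. Its leading monomial would be normal and yet divisible by an
    element of \<open>W\<close>.\<close>
  have indep: "c t = 0" if X: "finite X" "X \<subseteq> ?N" "(\<Sum>t\<in>X. sc (c t) (?v t)) = 0" "t \<in> X" for X c t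
  proof (rule ccontr)
    assume "c t \<noteq> 0"
    let ?p = "\<Sum>t\<in>X. Poly_Mapping.single t (c t)"
    have XT: "X \<subseteq> ?T" using X(2) by auto
    then have "?p \<in> C n" using kernel[of ?p] keys[OF X(1), of c] q_sum[OF X(1), of c] X(3) by auto
    moreover have "Poly_Mapping.lookup ?p t \<noteq> 0" using lookup[OF X(1), of c t] X(4) \<open>c t \<noteq> 0\<close> by simp
    then have p: "?p \<noteq> 0" by auto
    ultimately obtain m g where "(m, g) \<in> G" "g \<noteq> 0"
      "tree_divides (leading_monomial ord m g) (leading_monomial ord n ?p)"
      using groebner n unfolding groebner_basis_def by blast
    moreover have "leading_monomial ord n ?p \<in> X"
      using leading_monomial(1)[OF n \<open>?p \<in> C n\<close> p] keys[OF X(1), of c] by blast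
    ultimately show False using X(2) W by blast
  qed
  \<comment> \<open>Injectivity makes the dimension count the normal monomials and not just their
    distinct images.\<close>
  have inj: "inj_on ?v ?N"
  proof (rule inj_onI, rule ccontr)
    fix s t assume st: "s \<in> ?N" "t \<in> ?N" "?v s = ?v t" "s \<noteq> t"
    then have "(\<Sum>u\<in>{s, t}. sc (if u = s then 1 else - 1) (?v u)) = 0" by simp
    from indep[OF _ _ this, of s] st show False by auto
  qed
  have ind: "independent (?v ` ?N)"
    unfolding independent_explicit_finite_subsets
  proof (intro allI impI ballI)
    fix A u v assume A: "A \<subseteq> ?v ` ?N" "finite A" "(\<Sum>v\<in>A. sc (u v) v) = 0" "v \<in> A"
    then obtain X where X: "X \<subseteq> ?N" "finite X" "A = ?v ` X" by (meson finite_subset_image)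
    then have "(\<Sum>t\<in>X. sc (u (?v t)) (?v t)) = 0"
      using A(3) inj_on_subset[OF inj X(1)] by (simp add: sum.reindex)
    then show "u v = 0" using indep[OF X(2,1), of "\<lambda>t. u (?v t)"] A(4) X(3) by auto
  qed
  have sp: "span (?v ` ?N) = V"
  proof
    have "?v ` ?N \<subseteq> V" unfolding image[symmetric] by auto
    moreover have "subspace V" using subspace_span[of B] fin(2) by simp
    ultimately show "span (?v ` ?N) \<subseteq> V" by (rule span_minimal)
    have "q p \<in> span (?v ` ?N)" if "Poly_Mapping.keys p \<subseteq> ?T" for p
      unfolding q_expand[OF that] using that by (intro span_sum span_scale v_span) auto
    then show "V \<subseteq> span (?v ` ?N)" unfolding image[symmetric] by auto
  qed
  then have "?v ` ?N \<subseteq> span B" using fin(2) span_superset[of "?v ` ?N"] by simp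
  then have "finite (?v ` ?N)" using independent_span_bound[OF fin(1) ind] by blast
  moreover have "span V = V" using span_span[of B] fin(2) by simp
  then have "dim V = card (?v ` ?N)" by (intro dim_eq_card[OF _ ind]) (simp only: sp)
  ultimately show "finite ?N" "card ?N = dim V"
    using inj by (simp_all add: finite_image_iff card_image)
qed

end

section \<open>Dimensions and the generating series\<close>

theorem theorem0p1p3:
  fixes P :: "('k::field_char_0, 'p::ab_group_add) operad"
    and U :: "'g set" and ar :: "'g \<Rightarrow> nat"
    and C :: "nat \<Rightarrow> ('g tree \<Rightarrow>\<^sub>0 'k) set"
    and \<phi> :: "nat \<Rightarrow> ('g tree \<Rightarrow>\<^sub>0 'k) set \<Rightarrow> 'p"
    and ord :: "nat \<Rightarrow> ('g tree \<times> 'g tree) set"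
    and G :: "(nat \<times> ('g tree \<Rightarrow>\<^sub>0 'k)) set"
  assumes "ns_operad P"
    and "finitely_generated P"
    and "finite_dimensional_components P"
    and "finite U" and "\<And>a. a \<in> U \<Longrightarrow> ar a \<ge> 1"
    and "operad_ideal C (free_operad U ar)"
    and "quotient_isomorphism (free_operad U ar) C P \<phi>"
    and "admissible_order U ar ord"
    and "groebner_basis ord C G" and "finite G"
  shows "algebraic_series (generating_series P)"
proof -
  interpret free_operad_ideal U ar C ord by unfold_locales fact+
  let ?F = "free_operad U ar :: ('k, 'g tree \<Rightarrow>\<^sub>0 'k) operad"
  define W where "W = {leading_monomial ord m g | m g. (m, g) \<in> G \<and> g \<noteq> 0}"
  have "W \<subseteq> (\<lambda>(m, g). leading_monomial ord m g) ` G" by (force simp: W_def)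
  then have "finite W" using \<open>finite G\<close> by (rule finite_surj[rotated])
  have basis: "finite (normal_monomials W n) \<and>
      card (normal_monomials W n) = vector_space.dim (scale P) (component P n)" if n: "n \<ge> 1" for n
  proof -
    \<comment> \<open>The projection to the quotient followed by the isomorphism: it is linear on
      the \<open>n\<close>-ary component, with kernel \<open>C n\<close> and image
      \<open>component P n\<close>.\<close>
    let ?q = "\<lambda>x. \<phi> n (coset ?F C n x)"
    have comp: "component ?F n = {x. Poly_Mapping.keys x \<subseteq> tree_monomials U ar n}"
      by (simp add: free_operad_def)
    interpret F: ns_operad ?F by (rule free_operad_ns_operad)
    interpret Fv: vector_space "scale ?F" by (rule F.vector_space)
    have sub: "Fv.subspace (C n)"
      using \<open>operad_ideal C ?F\<close> n by (simp add: operad_ideal_def)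
    have subF: "Fv.subspace (component ?F n)" using F.subspace n by blast
    have C0: "0 \<in> C n" using sub by (rule Fv.subspace_0)
    have equiv: "equiv (component ?F n) (cong_mod ?F C n)"
    proof (rule equivI)
      show "sym (cong_mod ?F C n)"
        using Fv.subspace_neg[OF sub] by (force simp: sym_def cong_mod_def)
      show "trans (cong_mod ?F C n)"
        using Fv.subspace_add[OF sub] by (force simp: trans_def cong_mod_def)
    qed (use C0 in \<open>auto simp: refl_on_def cong_mod_def\<close>)
    have q_eq: "?q x = ?q y \<longleftrightarrow> x - y \<in> C n" if "x \<in> component ?F n" "y \<in> component ?F n" for x y
    proof -
      have "inj_on (\<phi> n) (component ?F n // cong_mod ?F C n)"
        using \<open>quotient_isomorphism ?F C P \<phi>\<close> n
        by (auto simp: quotient_isomorphism_def bij_betw_def)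
      then have "?q x = ?q y \<longleftrightarrow> coset ?F C n x = coset ?F C n y"
        unfolding coset_def by (rule inj_on_eq_iff) (use that in \<open>auto intro: quotientI\<close>)
      also have "\<dots> \<longleftrightarrow> (x, y) \<in> cong_mod ?F C n"
        unfolding coset_def using eq_equiv_class_iff[OF equiv that] .
      finally show ?thesis using that by (simp add: cong_mod_def)
    qed
    have vs: "vector_space (scale P)" using \<open>ns_operad P\<close> by (rule ns_operad.vector_space)
    then interpret Pv: vector_space "scale P" .
    have q_add: "?q (x + y) = ?q x + ?q y" if "x \<in> component ?F n" "y \<in> component ?F n" for x y
      using \<open>quotient_isomorphism ?F C P \<phi>\<close> n that by (simp add: quotient_isomorphism_def)
    have q_scale: "?q (scale ?F c x) = scale P c (?q x)" if "x \<in> component ?F n" for c x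
      using \<open>quotient_isomorphism ?F C P \<phi>\<close> n that by (simp add: quotient_isomorphism_def)
    have F0: "0 \<in> component ?F n" using subF by (rule Fv.subspace_0)
    have q0: "?q 0 = 0" using q_add[OF F0 F0] by simp
    have "?q ` component ?F n = component P n"
    proof -
      have "component ?F n // cong_mod ?F C n = coset ?F C n ` component ?F n"
        by (auto simp: quotient_def coset_def)
      moreover have "\<phi> n ` (component ?F n // cong_mod ?F C n) = component P n"
        using \<open>quotient_isomorphism ?F C P \<phi>\<close> n by (simp add: quotient_isomorphism_def bij_betw_def)
      ultimately show ?thesis by (simp add: image_image)
    qed
    moreover obtain B where "finite B" "module.span (scale P) B = component P n"
      using \<open>finite_dimensional_components P\<close> n by (auto simp: finite_dimensional_components_def)
    ultimately show ?thesis
      using q_add q_scale q_eq[OF _ F0] q0 comp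
      by (intro conjI normal_monomials_basis[OF vs n \<open>groebner_basis ord C G\<close> W_def, of ?q "component P n" B])
        (auto simp: free_operad_def)
  qed
  let ?A = "\<lambda>n. {s \<in> trees U ar. leaves s = n \<and> (\<forall>w\<in>W. \<not> tree_divides w s)}"
  have A: "?A n = normal_monomials W n" for n by (auto simp: tree_monomials_def)
  \<comment> \<open>Arity \<open>0\<close> is outside the range of \<open>basis\<close>; the absence
    of such trees matches the constant coefficient \<open>0\<close> of
    \<open>generating_series\<close>.\<close>
  have A0: "?A 0 = {}" using leaves_ge_1[of U ar] ar by force
  have "finite (?A n)" for n
  proof (cases "n = 0")
    case True
    then show ?thesis by (simp only: A0 finite.emptyI)
  qed (use basis[of n] A[of n] in simp)
  then have "algebraic_series (Abs_fps (\<lambda>n. of_nat (card (?A n))))"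
    by (rule avoiding_series_algebraic[OF \<open>finite U\<close> \<open>finite W\<close>])
  also have "Abs_fps (\<lambda>n. of_nat (card (?A n))) = generating_series P"
    unfolding generating_series_def using basis A A0
    by (intro arg_cong[where f = Abs_fps] ext) (auto simp del: Collect_empty_eq)
  finally show ?thesis .
qed

end
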